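(* Let $I\subset\mathbb{R}$ be an open interval and let $a,b,c:I\to\mathbb{R}\setminus\{0\}$ be smooth functions satisfying $$\frac{d}{dt}a=\frac{c^2-a^2}{2bc},\qquad \frac{d}{dt}b=\frac{(c+a)^2}{2ca},\qquad \frac{d}{dt}c=\frac{a^2-c^2}{2ab}.$$ Then the pseudo-Riemannian metric of signature $(2,2)$ $$g=dt^2+a(t)^2(\theta^1)^2-b(t)^2(\theta^2)^2-c(t)^2(\theta^3)^2$$ on $I\times E(1,1)$ is Ricci-flat.
   Context: $E(1,1)$ denotes the 3-dimensional simply connected unimodular Lie group of rigid motions of the Minkowski 2-space. $\{F_1,F_2,F_3\}$ is a left-invariant frame on $E(1,1)$ with $[F_1,F_2]=-F_3$, $[F_3,F_1]=0$, $[F_2,F_3]=F_1$, and $\{\theta^1,\theta^2,\theta^3\}$ is the dual left-invariant coframe. The displayed ODE system is the Ricci flow equation, in the convention $\partial_t g_{ij}=-\mathrm{Ric}[g]_{ij}$, for the left-invariant metrics $a(\theta^1)^2+b(\theta^2)^2+c(\theta^3)^2$ on $E(1,1)$. A metric is Ricci-flat if its Ricci tensor vanishes identically. *)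

theory Defs
  imports "HOL-Analysis.Analysis"
begin

section \<open>Pseudo-Riemannian geometry on open subsets of a Euclidean space\<close>

text \<open>
  All manifolds here are covered by a single global chart, so a manifold is an open set
  \<open>U\<close> in a Euclidean space \<open>'a\<close>, every tangent space is \<open>'a\<close> itself, a vector field
  is a function \<open>'a \<Rightarrow> 'a\<close>, and a metric tensor is a function \<open>g\<close> with \<open>g p u v\<close> the value
  at the point \<open>p\<close> on the tangent vectors \<open>u\<close>, \<open>v\<close>.
\<close>

text \<open>Intended for open \<open>S\<close>. A function is \<open>C^(k+1)\<close> if it is differentiable with all
  directional derivatives \<open>C^k\<close>.\<close>

primrec Ck_on :: "nat \<Rightarrow> 'a::real_normed_vector set \<Rightarrow> ('a \<Rightarrow> 'b::real_normed_vector) \<Rightarrow> bool" where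
  "Ck_on 0 S f \<longleftrightarrow> continuous_on S f"
| "Ck_on (Suc k) S f \<longleftrightarrow>
     (\<forall>x\<in>S. f differentiable (at x)) \<and> (\<forall>v. Ck_on k S (\<lambda>x. frechet_derivative f (at x) v))"

definition smooth_on :: "'a::real_normed_vector set \<Rightarrow> ('a \<Rightarrow> 'b::real_normed_vector) \<Rightarrow> bool" where
  "smooth_on S f \<longleftrightarrow> (\<forall>k. Ck_on k S f)"

definition lie_bracket :: "('a::real_normed_vector \<Rightarrow> 'a) \<Rightarrow> ('a \<Rightarrow> 'a) \<Rightarrow> 'a \<Rightarrow> 'a" where
  "lie_bracket X Y p =
     frechet_derivative Y (at p) (X p) - frechet_derivative X (at p) (Y p)"

text \<open>\<open>r\<close> is the number of positive and \<open>s\<close> the number of negative vectors in an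
  orthonormal basis (in the sense of \<open>B\<close>).\<close>

definition has_signature :: "('a::euclidean_space \<Rightarrow> 'a \<Rightarrow> real) \<Rightarrow> nat \<Rightarrow> nat \<Rightarrow> bool" where
  "has_signature B r s \<longleftrightarrow>
     (\<exists>P N. finite P \<and> finite N \<and> card P = r \<and> card N = s \<and> P \<inter> N = {} \<and>
        independent (P \<union> N) \<and> span (P \<union> N) = UNIV \<and>
        (\<forall>u\<in>P. B u u = 1) \<and> (\<forall>u\<in>N. B u u = -1) \<and>
        (\<forall>u\<in>P \<union> N. \<forall>v\<in>P \<union> N. u \<noteq> v \<longrightarrow> B u v = 0))"

definition pseudo_riemannian_metric_on ::
    "'a::euclidean_space set \<Rightarrow> nat \<Rightarrow> nat \<Rightarrow> ('a \<Rightarrow> 'a \<Rightarrow> 'a \<Rightarrow> real) \<Rightarrow> bool" where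
  "pseudo_riemannian_metric_on U r s g \<longleftrightarrow>
     open U \<and> (\<forall>u v. smooth_on U (\<lambda>p. g p u v)) \<and>
     (\<forall>p\<in>U. bilinear (g p) \<and> (\<forall>u v. g p u v = g p v u) \<and> has_signature (g p) r s)"

text \<open>The Christoffel symbols as a vector-valued form: for basis vectors \<open>u = e\<^sub>i\<close>,
  \<open>v = e\<^sub>j\<close> this is \<open>\<Sum>k. \<Gamma>\<^sup>k\<^sub>i\<^sub>j e\<^sub>k\<close>, the defining equation being
  \<open>g\<^sub>l\<^sub>k \<Gamma>\<^sup>k\<^sub>i\<^sub>j = (\<partial>\<^sub>i g\<^sub>j\<^sub>l + \<partial>\<^sub>j g\<^sub>i\<^sub>l - \<partial>\<^sub>l g\<^sub>i\<^sub>j) / 2\<close>. Its solution is unique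
  because \<open>g p\<close> is nondegenerate.\<close>

definition christoffel ::
    "('a::euclidean_space \<Rightarrow> 'a \<Rightarrow> 'a \<Rightarrow> real) \<Rightarrow> 'a \<Rightarrow> 'a \<Rightarrow> 'a \<Rightarrow> 'a" where
  "christoffel g p u v = (THE w. \<forall>z. g p w z =
     (frechet_derivative (\<lambda>q. g q v z) (at p) u
      + frechet_derivative (\<lambda>q. g q u z) (at p) v
      - frechet_derivative (\<lambda>q. g q u v) (at p) z) / 2)"

text \<open>The covariant derivative of \<open>Y\<close> in direction \<open>X\<close> for the Levi-Civita connection of \<open>g\<close>.\<close>

definition levi_civita ::
    "('a::euclidean_space \<Rightarrow> 'a \<Rightarrow> 'a \<Rightarrow> real) \<Rightarrow> ('a \<Rightarrow> 'a) \<Rightarrow> ('a \<Rightarrow> 'a) \<Rightarrow> 'a \<Rightarrow> 'a" where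
  "levi_civita g X Y p = frechet_derivative Y (at p) (X p) + christoffel g p (X p) (Y p)"

text \<open>\<open>R(X,Y)Z\<close>.\<close>

definition riemann_curvature ::
    "('a::euclidean_space \<Rightarrow> 'a \<Rightarrow> 'a \<Rightarrow> real) \<Rightarrow>
     ('a \<Rightarrow> 'a) \<Rightarrow> ('a \<Rightarrow> 'a) \<Rightarrow> ('a \<Rightarrow> 'a) \<Rightarrow> 'a \<Rightarrow> 'a" where
  "riemann_curvature g X Y Z p =
     levi_civita g X (levi_civita g Y Z) p - levi_civita g Y (levi_civita g X Z) p
     - levi_civita g (lie_bracket X Y) Z p"

text \<open>\<open>Ric(u,v)\<close> is the trace of \<open>w \<mapsto> R(w,u)v\<close>. Since \<open>R\<close> is tensorial, the tangent vectors
  may be extended to constant vector fields.\<close>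

definition ricci ::
    "('a::euclidean_space \<Rightarrow> 'a \<Rightarrow> 'a \<Rightarrow> real) \<Rightarrow> 'a \<Rightarrow> 'a \<Rightarrow> 'a \<Rightarrow> real" where
  "ricci g p u v =
     (\<Sum>e\<in>Basis. riemann_curvature g (\<lambda>_. e) (\<lambda>_. u) (\<lambda>_. v) p \<bullet> e)"

definition ricci_flat_on ::
    "'a::euclidean_space set \<Rightarrow> ('a \<Rightarrow> 'a \<Rightarrow> 'a \<Rightarrow> real) \<Rightarrow> bool" where
  "ricci_flat_on U g \<longleftrightarrow> (\<forall>p\<in>U. \<forall>u v. ricci g p u v = 0)"


section \<open>The Lie group \<open>E(1,1)\<close>\<close>

text \<open>The element \<open>(w, s)\<close> is the motion \<open>v \<mapsto> boost s v + w\<close> of the Minkowski plane. These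
  motions form the identity component of the isometry group of that plane, which is the
  simply connected group \<open>E(1,1)\<close>; the type itself is a global chart.\<close>

type_synonym e11 = "(real \<times> real) \<times> real"

definition boost :: "real \<Rightarrow> real \<times> real \<Rightarrow> real \<times> real" where
  "boost s v = (cosh s * fst v + sinh s * snd v, sinh s * fst v + cosh s * snd v)"

definition e11_act :: "e11 \<Rightarrow> real \<times> real \<Rightarrow> real \<times> real" where
  "e11_act p v = boost (snd p) v + fst p"

definition e11_mult :: "e11 \<Rightarrow> e11 \<Rightarrow> e11" where
  "e11_mult p q = (fst p + boost (snd p) (fst q), snd p + snd q)"

lemma boost_minkowski: "(fst (boost s v))\<^sup>2 - (snd (boost s v))\<^sup>2 = (fst v)\<^sup>2 - (snd v)\<^sup>2"
proof -
  have "(fst (boost s v))\<^sup>2 - (snd (boost s v))\<^sup>2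
      = ((cosh s)\<^sup>2 - (sinh s)\<^sup>2) * ((fst v)\<^sup>2 - (snd v)\<^sup>2)"
    by (simp add: boost_def power2_eq_square algebra_simps)
  then show ?thesis
    by (simp add: hyperbolic_pythagoras)
qed

lemma e11_act_mult: "e11_act (e11_mult p q) v = e11_act p (e11_act q v)"
  by (simp add: e11_act_def e11_mult_def boost_def prod_eq_iff cosh_add sinh_add algebra_simps)

lemma e11_act_faithful: "e11_act p = e11_act q \<Longrightarrow> p = q"
proof -
  assume eq: "e11_act p = e11_act q"
  have "fst p = fst q"
    using fun_cong[OF eq, of 0] by (simp add: e11_act_def boost_def flip: zero_prod_def)
  moreover have "sinh (snd p) = sinh (snd q)"
    using fun_cong[OF eq, of "(1, 0)"] \<open>fst p = fst q\<close> by (simp add: e11_act_def boost_def)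
  ultimately show "p = q"
    by (simp add: prod_eq_iff)
qed

definition left_invariant :: "(e11 \<Rightarrow> e11) \<Rightarrow> bool" where
  "left_invariant X \<longleftrightarrow>
     (\<forall>p q. frechet_derivative (e11_mult p) (at q) (X q) = X (e11_mult p q))"

definition left_invariant_frame ::
    "(e11 \<Rightarrow> e11) \<Rightarrow> (e11 \<Rightarrow> e11) \<Rightarrow> (e11 \<Rightarrow> e11) \<Rightarrow> bool" where
  "left_invariant_frame F1 F2 F3 \<longleftrightarrow>
     left_invariant F1 \<and> left_invariant F2 \<and> left_invariant F3 \<and>
     (\<forall>p. distinct [F1 p, F2 p, F3 p] \<and>
          independent {F1 p, F2 p, F3 p} \<and> span {F1 p, F2 p, F3 p} = UNIV)"

text \<open>A one-form \<open>\<theta>\<close> is given by its values \<open>\<theta> p u\<close> on tangent vectors \<open>u\<close> at \<open>p\<close>.\<close>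

definition dual_coframe ::
    "(e11 \<Rightarrow> e11) \<Rightarrow> (e11 \<Rightarrow> e11) \<Rightarrow> (e11 \<Rightarrow> e11) \<Rightarrow>
     (e11 \<Rightarrow> e11 \<Rightarrow> real) \<Rightarrow> (e11 \<Rightarrow> e11 \<Rightarrow> real) \<Rightarrow> (e11 \<Rightarrow> e11 \<Rightarrow> real) \<Rightarrow> bool" where
  "dual_coframe F1 F2 F3 \<theta>1 \<theta>2 \<theta>3 \<longleftrightarrow>
     (\<forall>p. linear (\<theta>1 p) \<and> linear (\<theta>2 p) \<and> linear (\<theta>3 p) \<and>
        \<theta>1 p (F1 p) = 1 \<and> \<theta>1 p (F2 p) = 0 \<and> \<theta>1 p (F3 p) = 0 \<and>
        \<theta>2 p (F1 p) = 0 \<and> \<theta>2 p (F2 p) = 1 \<and> \<theta>2 p (F3 p) = 0 \<and>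
        \<theta>3 p (F1 p) = 0 \<and> \<theta>3 p (F2 p) = 0 \<and> \<theta>3 p (F3 p) = 1)"

text \<open>The metric \<open>dt\<^sup>2 + a(t)\<^sup>2 (\<theta>\<^sup>1)\<^sup>2 - b(t)\<^sup>2 (\<theta>\<^sup>2)\<^sup>2 - c(t)\<^sup>2 (\<theta>\<^sup>3)\<^sup>2\<close>, where points are
  pairs \<open>(t, p)\<close> and \<open>dt (\<tau>, u) = \<tau>\<close>.\<close>

definition flow_metric ::
    "(real \<Rightarrow> real) \<Rightarrow> (real \<Rightarrow> real) \<Rightarrow> (real \<Rightarrow> real) \<Rightarrow>
     (e11 \<Rightarrow> e11 \<Rightarrow> real) \<Rightarrow> (e11 \<Rightarrow> e11 \<Rightarrow> real) \<Rightarrow> (e11 \<Rightarrow> e11 \<Rightarrow> real) \<Rightarrow>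
     real \<times> e11 \<Rightarrow> real \<times> e11 \<Rightarrow> real \<times> e11 \<Rightarrow> real" where
  "flow_metric a b c \<theta>1 \<theta>2 \<theta>3 = (\<lambda>(t, p) (\<tau>, u) (\<sigma>, v).
     \<tau> * \<sigma> + (a t)\<^sup>2 * (\<theta>1 p u * \<theta>1 p v)
           - (b t)\<^sup>2 * (\<theta>2 p u * \<theta>2 p v)
           - (c t)\<^sup>2 * (\<theta>3 p u * \<theta>3 p v))"

end

theory Submission
  imports Defs
begin

text \<open>
  In the frame \<open>\<partial>\<^sub>t, F1, F2, F3\<close> the metric is diagonal with coefficients that depend on \<open>t\<close> only, and
  the frame has constant structure. Hence connection and curvature are algebraic in \<open>a\<close>, \<open>b\<close>, \<open>c\<close> and
  their \<open>t\<close>-derivatives, and the Ricci tensor comes out diagonal. Put \<open>k = (c\<^sup>2 - a\<^sup>2) / (2abc)\<close> and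
  \<open>m = (a + c)\<^sup>2 / (2abc)\<close>. The flow equations say \<open>a' = k a\<close>, \<open>b' = m b\<close>, \<open>c' = - k c\<close>, and they imply
  \<open>m' = - m\<^sup>2 - 2 k\<^sup>2\<close> and \<open>k' = - k (m + (a\<^sup>2 + c\<^sup>2) / (abc))\<close>. With these,
  \<open>Ric(\<partial>\<^sub>t, \<partial>\<^sub>t) = - (a''/a + b''/b + c''/c) = - (m' + m\<^sup>2 + 2 k\<^sup>2)\<close> is zero, and in the directions of
  the \<open>F\<close>s the extrinsic terms, such as \<open>b''/b = - 2 k\<^sup>2 = - (c\<^sup>2 - a\<^sup>2)\<^sup>2 / (2 a\<^sup>2 b\<^sup>2 c\<^sup>2)\<close>, are cancelled
  exactly by the Ricci tensor of the left-invariant metric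
  \<open>a\<^sup>2 (\<theta>\<^sup>1)\<^sup>2 - b\<^sup>2 (\<theta>\<^sup>2)\<^sup>2 - c\<^sup>2 (\<theta>\<^sup>3)\<^sup>2\<close> on the slices. This is the lemma
  \<open>flow_curvature_trace\<close>.

  The curvature is defined by derivatives in a chart, so two bridges are needed. The locale
  \<open>framed_metric\<close> shows that for any metric with a sufficiently homogeneous frame the
  Christoffel symbols, the curvature and the Ricci tensor of the chart are given by the expected
  expressions in frame coordinates: a connection that is torsion-free and compatible with the metric
  solves the Koszul equation, and the solution is unique. The locale \<open>lorentz_frame\<close>
  determines the derivatives of \<open>F1\<close>, \<open>F2\<close>, \<open>F3\<close> and of the dual coframe in the chart from left
  invariance and the bracket relations: every derivative is \<open>\<theta>\<^sup>2\<close> of the direction times a fixed linear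
  combination of the frame or coframe. The same derivative formulas give smoothness of the metric.
\<close>

section \<open>Curvature in a moving frame\<close>

text \<open>The product rule for a linear map applied to a vector when both vary with the point. Only the
values of the map on fixed vectors are assumed differentiable; in finite dimension this suffices,
because the map is a combination of its values on a basis.\<close>

lemma has_derivative_linear_family:
  fixes L :: "'a::real_normed_vector \<Rightarrow> 'b::euclidean_space \<Rightarrow> 'c::real_normed_vector"
  assumes lin: "\<And>q. linear (L q)"
    and L: "\<And>x. ((\<lambda>q. L q x) has_derivative L' x) (at p)"
    and f: "(f has_derivative f') (at p)"
  shows "((\<lambda>q. L q (f q)) has_derivative (\<lambda>u. L' (f p) u + L p (f' u))) (at p)"
proof -
  have expand: "L q x = (\<Sum>i\<in>Basis. (x \<bullet> i) *\<^sub>R L q i)" for q x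
    by (subst euclidean_representation[of x, symmetric])
      (simp only: linear_sum[OF lin] linear_scale[OF lin])
  have "((\<lambda>q. \<Sum>i\<in>Basis. (f q \<bullet> i) *\<^sub>R L q i) has_derivative
      (\<lambda>u. \<Sum>i\<in>Basis. (f p \<bullet> i) *\<^sub>R L' i u + (f' u \<bullet> i) *\<^sub>R L p i)) (at p)"
    by (intro has_derivative_sum has_derivative_scaleR has_derivative_inner_left f L)
  moreover have "((\<lambda>q. \<Sum>i\<in>Basis. (f p \<bullet> i) *\<^sub>R L q i) has_derivative
      (\<lambda>u. \<Sum>i\<in>Basis. (f p \<bullet> i) *\<^sub>R L' i u)) (at p)"
    by (intro has_derivative_sum has_derivative_scaleR_right L)
  then have "((\<lambda>q. L q (f p)) has_derivative (\<lambda>u. \<Sum>i\<in>Basis. (f p \<bullet> i) *\<^sub>R L' i u)) (at p)"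
    by (simp flip: expand)
  then have "L' (f p) = (\<lambda>u. \<Sum>i\<in>Basis. (f p \<bullet> i) *\<^sub>R L' i u)"
    by (rule has_derivative_unique[OF L])
  ultimately show ?thesis
    by (simp add: sum.distrib flip: expand)
qed

lemma has_derivative_bilinear_family:
  fixes N :: "'a::real_normed_vector \<Rightarrow> 'b::euclidean_space \<Rightarrow> 'b \<Rightarrow> 'c::real_normed_vector"
  assumes bil: "\<And>q. bilinear (N q)"
    and N: "\<And>x y. ((\<lambda>q. N q x y) has_derivative N' x y) (at p)"
    and f: "(f has_derivative f') (at p)" and g: "(g has_derivative g') (at p)"
  shows "((\<lambda>q. N q (f q) (g q)) has_derivative
           (\<lambda>u. N' (f p) (g p) u + N p (f' u) (g p) + N p (f p) (g' u))) (at p)"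
proof -
  have "((\<lambda>q. N q (f q) y) has_derivative (\<lambda>u. N' (f p) y u + N p (f' u) y)) (at p)" for y
    using bil by (intro has_derivative_linear_family[where L = "\<lambda>q x. N q x y"] N f)
      (auto simp: bilinear_def)
  then show ?thesis
    using bil by (intro has_derivative_linear_family[where L = "\<lambda>q. N q (f q)"] g)
      (auto simp: bilinear_def)
qed

text \<open>The trace in the definition of \<^const>\<open>ricci\<close> is taken in the basis of the chart; by this
invariance it can be taken in the coordinates of a moving frame instead.\<close>

lemma trace_conjugate:
  fixes F :: "'b::euclidean_space \<Rightarrow> 'a::euclidean_space" and M :: "'a \<Rightarrow> 'b"
  assumes "linear F" "linear M"
  shows "(\<Sum>e\<in>Basis. F (M e) \<bullet> e) = (\<Sum>b\<in>Basis. M (F b) \<bullet> b)"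
proof -
  have "(\<Sum>e\<in>Basis. F (M e) \<bullet> e) = (\<Sum>e\<in>Basis. \<Sum>b\<in>Basis. (M e \<bullet> b) * (F b \<bullet> e))"
  proof (rule sum.cong[OF refl])
    fix e :: 'a
    have "F (M e) = (\<Sum>b\<in>Basis. (M e \<bullet> b) *\<^sub>R F b)"
      by (subst euclidean_representation[of "M e", symmetric])
        (simp only: linear_sum[OF assms(1)] linear_scale[OF assms(1)])
    then show "F (M e) \<bullet> e = (\<Sum>b\<in>Basis. (M e \<bullet> b) * (F b \<bullet> e))"
      by (simp add: inner_sum_left)
  qed
  also have "\<dots> = (\<Sum>b\<in>Basis. \<Sum>e\<in>Basis. (M e \<bullet> b) * (F b \<bullet> e))"
    by (rule sum.swap)
  also have "\<dots> = (\<Sum>b\<in>Basis. M (F b) \<bullet> b)"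
  proof (rule sum.cong[OF refl])
    fix b :: 'b
    have "M (F b) = (\<Sum>e\<in>Basis. (F b \<bullet> e) *\<^sub>R M e)"
      by (subst euclidean_representation[of "F b", symmetric])
        (simp only: linear_sum[OF assms(2)] linear_scale[OF assms(2)])
    then show "(\<Sum>e\<in>Basis. (M e \<bullet> b) * (F b \<bullet> e)) = M (F b) \<bullet> b"
      by (simp add: inner_sum_left mult.commute)
  qed
  finally show ?thesis .
qed

text \<open>A metric described by a moving frame. Vectors of the model space \<open>'b\<close> are coefficient vectors:
\<open>E p\<close> turns coefficients into a tangent vector at \<open>p\<close>, and \<open>\<Theta> p\<close> is its inverse, the coframe. The
frame is supposed to be so homogeneous that its derivative in the chart has constant coefficients
\<open>B\<close>: the field with constant coefficients \<open>y\<close> changes in the direction \<open>E p x\<close> by \<open>E p (B x y)\<close>.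
Then \<open>B x y - B y x\<close> are the coefficients of the commutator of two frame fields, and \<open>B_flat\<close>
says that mixed partial derivatives in the chart commute.

The metric has coefficients \<open>h\<close> in the frame, and \<open>N\<close> is a candidate for the connection
coefficients, \<open>\<nabla>\<^bsub>E x\<^esub> E y = E (N x y)\<close>; it must be compatible with \<open>h\<close> and torsion-free. Finally
\<open>N' p x\<close> is the derivative of \<open>N\<close> in the direction \<open>E p x\<close>.\<close>

locale framed_metric =
  fixes U :: "'a::euclidean_space set"
    and \<Theta> :: "'a \<Rightarrow> 'a \<Rightarrow> 'b::euclidean_space" and E :: "'a \<Rightarrow> 'b \<Rightarrow> 'a"
    and B :: "'b \<Rightarrow> 'b \<Rightarrow> 'b"
    and h :: "'a \<Rightarrow> 'b \<Rightarrow> 'b \<Rightarrow> real"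
    and N :: "'a \<Rightarrow> 'b \<Rightarrow> 'b \<Rightarrow> 'b" and N' :: "'a \<Rightarrow> 'b \<Rightarrow> 'b \<Rightarrow> 'b \<Rightarrow> 'b"
  assumes open_U: "open U"
    and linear_coframe: "\<And>p. linear (\<Theta> p)" and linear_frame: "\<And>p. linear (E p)"
    and coframe_frame: "\<And>p x. \<Theta> p (E p x) = x" and frame_coframe: "\<And>p u. E p (\<Theta> p u) = u"
    and bilinear_B: "bilinear B" and bilinear_h: "\<And>p. bilinear (h p)"
    and bilinear_N: "\<And>p. bilinear (N p)"
    and linear_N'1: "\<And>p y z. linear (\<lambda>x. N' p x y z)"
    and linear_N'2: "\<And>p x z. linear (\<lambda>y. N' p x y z)"
    and coframe_derivative:
      "\<And>p v. ((\<lambda>q. \<Theta> q v) has_derivative (\<lambda>u. - B (\<Theta> p u) (\<Theta> p v))) (at p)"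
    and frame_derivative:
      "\<And>p y. ((\<lambda>q. E q y) has_derivative (\<lambda>u. E p (B (\<Theta> p u) y))) (at p)"
    and B_flat: "\<And>x y z. B x (B y z) - B y (B x z) = B (B x y - B y x) z"
    and symmetric_h: "\<And>p x y. h p x y = h p y x"
    and nondegenerate_h: "\<And>p x. p \<in> U \<Longrightarrow> (\<And>y. h p x y = 0) \<Longrightarrow> x = 0"
    and metric_compatible: "\<And>p x y. p \<in> U \<Longrightarrow>
      ((\<lambda>q. h q x y) has_derivative
        (\<lambda>u. h p (N p (\<Theta> p u) x) y + h p x (N p (\<Theta> p u) y))) (at p)"
    and torsion_free: "\<And>p x y. p \<in> U \<Longrightarrow> N p x y - N p y x = B x y - B y x"
    and N_derivative: "\<And>p x y. p \<in> U \<Longrightarrow>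
      ((\<lambda>q. N q x y) has_derivative (\<lambda>u. N' p (\<Theta> p u) x y)) (at p)"
begin

definition frame_metric :: "'a \<Rightarrow> 'a \<Rightarrow> 'a \<Rightarrow> real"
  where "frame_metric p u v = h p (\<Theta> p u) (\<Theta> p v)"

text \<open>The usual curvature expression \<open>[\<nabla>\<^sub>x, \<nabla>\<^sub>y] z - \<nabla>\<^bsub>[x, y]\<^esub> z\<close> for frame fields with constant
coefficients.\<close>

definition frame_curvature :: "'a \<Rightarrow> 'b \<Rightarrow> 'b \<Rightarrow> 'b \<Rightarrow> 'b" where
  "frame_curvature p x y z =
     N' p x y z - N' p y x z + N p x (N p y z) - N p y (N p x z) - N p (B x y - B y x) z"

lemmas frame_linear_simps =
  linear_add[OF linear_coframe] linear_diff[OF linear_coframe]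
  linear_add[OF linear_frame] linear_diff[OF linear_frame]
lemmas B_simps = bilinear_ladd[OF bilinear_B] bilinear_radd[OF bilinear_B]
  bilinear_lsub[OF bilinear_B] bilinear_rsub[OF bilinear_B]
  bilinear_lneg[OF bilinear_B] bilinear_rneg[OF bilinear_B]
lemmas h_simps = bilinear_ladd[OF bilinear_h] bilinear_radd[OF bilinear_h]
  bilinear_lsub[OF bilinear_h] bilinear_rsub[OF bilinear_h]
  bilinear_lneg[OF bilinear_h] bilinear_rneg[OF bilinear_h]
lemmas N_simps = bilinear_ladd[OF bilinear_N] bilinear_radd[OF bilinear_N]
  bilinear_lsub[OF bilinear_N] bilinear_rsub[OF bilinear_N]
  bilinear_lneg[OF bilinear_N] bilinear_rneg[OF bilinear_N]

lemma frame_metric_derivative: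
  assumes "p \<in> U"
  shows "frechet_derivative (\<lambda>q. frame_metric q v z) (at p) u =
    h p (N p (\<Theta> p u) (\<Theta> p v) - B (\<Theta> p u) (\<Theta> p v)) (\<Theta> p z)
    + h p (\<Theta> p v) (N p (\<Theta> p u) (\<Theta> p z) - B (\<Theta> p u) (\<Theta> p z))"
proof -
  have "((\<lambda>q. frame_metric q v z) has_derivative
     (\<lambda>u. h p (N p (\<Theta> p u) (\<Theta> p v)) (\<Theta> p z) + h p (\<Theta> p v) (N p (\<Theta> p u) (\<Theta> p z))
        + h p (- B (\<Theta> p u) (\<Theta> p v)) (\<Theta> p z) + h p (\<Theta> p v) (- B (\<Theta> p u) (\<Theta> p z)))) (at p)"
    unfolding frame_metric_def
    by (intro has_derivative_bilinear_family bilinear_h metric_compatible assms coframe_derivative)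
  from frechet_derivative_at[OF this, symmetric] show ?thesis
    by (simp add: h_simps)
qed

text \<open>In the chart, constant vector fields do not have constant coefficients in the frame, which
accounts for the correction by \<open>B\<close>. The difference \<open>N - B\<close> is symmetric because \<open>N\<close> is
torsion-free, and together with metric compatibility this is the Koszul argument; uniqueness
is nondegeneracy.\<close>

lemma christoffel_frame:
  assumes "p \<in> U"
  shows "christoffel frame_metric p u v =
    E p (N p (\<Theta> p u) (\<Theta> p v) - B (\<Theta> p u) (\<Theta> p v))" (is "_ = ?w")
  unfolding christoffel_def
proof (rule the_equality)
  let ?K = "\<lambda>z. (frechet_derivative (\<lambda>q. frame_metric q v z) (at p) u
      + frechet_derivative (\<lambda>q. frame_metric q u z) (at p) v
      - frechet_derivative (\<lambda>q. frame_metric q u v) (at p) z) / 2"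
  have swap: "N p x y - B x y = N p y x - B y x" for x y
    using torsion_free[OF assms, of x y] by (simp add: algebra_simps)
  have koszul: "frame_metric p ?w z = ?K z" for z
    unfolding frame_metric_derivative[OF assms]
    unfolding frame_metric_def coframe_frame swap[of "\<Theta> p v" "\<Theta> p u"] swap[of "\<Theta> p z"]
    by (simp add: symmetric_h[of p "\<Theta> p v"] symmetric_h[of p "\<Theta> p u"])
  then show "\<forall>z. frame_metric p ?w z = ?K z"
    by blast
  fix w
  assume "\<forall>z. frame_metric p w z = ?K z"
  then have eq: "frame_metric p w z = frame_metric p ?w z" for z
    using koszul[of z] by metis
  have "\<Theta> p (w - ?w) = 0"
  proof (rule nondegenerate_h[OF assms])
    fix y
    show "h p (\<Theta> p (w - ?w)) y = 0"
      using eq[of "E p y"]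
      by (simp add: frame_metric_def coframe_frame frame_linear_simps h_simps)
  qed
  then have "w - ?w = E p 0"
    by (metis frame_coframe)
  then show "w = ?w"
    by (simp add: linear_0[OF linear_frame])
qed

lemma christoffel_field_derivative:
  assumes "p \<in> U"
  defines "\<Gamma> \<equiv> \<lambda>x y. N p x y - B x y"
  shows "frechet_derivative (\<lambda>q. christoffel frame_metric q v z) (at p) u =
    E p (B (\<Theta> p u) (\<Gamma> (\<Theta> p v) (\<Theta> p z))
      + N' p (\<Theta> p u) (\<Theta> p v) (\<Theta> p z)
      - \<Gamma> (B (\<Theta> p u) (\<Theta> p v)) (\<Theta> p z) - \<Gamma> (\<Theta> p v) (B (\<Theta> p u) (\<Theta> p z)))"
proof -
  have N: "((\<lambda>q. N q (\<Theta> q v) (\<Theta> q z)) has_derivative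
    (\<lambda>u. N' p (\<Theta> p u) (\<Theta> p v) (\<Theta> p z) + N p (- B (\<Theta> p u) (\<Theta> p v)) (\<Theta> p z)
       + N p (\<Theta> p v) (- B (\<Theta> p u) (\<Theta> p z)))) (at p)"
    by (intro has_derivative_bilinear_family bilinear_N N_derivative assms coframe_derivative)
  have Bd: "((\<lambda>q. B (\<Theta> q v) (\<Theta> q z)) has_derivative
    (\<lambda>u. 0 + B (- B (\<Theta> p u) (\<Theta> p v)) (\<Theta> p z)
       + B (\<Theta> p v) (- B (\<Theta> p u) (\<Theta> p z)))) (at p)"
    by (intro has_derivative_bilinear_family[where N = "\<lambda>_. B"] bilinear_B coframe_derivative
      has_derivative_const)
  have "((\<lambda>q. E q (N q (\<Theta> q v) (\<Theta> q z) - B (\<Theta> q v) (\<Theta> q z))) has_derivative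
    (\<lambda>u. E p (B (\<Theta> p u) (N p (\<Theta> p v) (\<Theta> p z) - B (\<Theta> p v) (\<Theta> p z)))
      + E p ((N' p (\<Theta> p u) (\<Theta> p v) (\<Theta> p z) + N p (- B (\<Theta> p u) (\<Theta> p v)) (\<Theta> p z)
       + N p (\<Theta> p v) (- B (\<Theta> p u) (\<Theta> p z)))
      - (0 + B (- B (\<Theta> p u) (\<Theta> p v)) (\<Theta> p z)
       + B (\<Theta> p v) (- B (\<Theta> p u) (\<Theta> p z)))))) (at p)" (is "(_ has_derivative ?D) _")
    by (rule has_derivative_linear_family[OF linear_frame frame_derivative
      has_derivative_diff[OF N Bd]])
  then have "((\<lambda>q. christoffel frame_metric q v z) has_derivative ?D) (at p)"
    by (rule has_derivative_transform_within_open[OF _ open_U assms(1)])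
      (simp add: christoffel_frame)
  from frechet_derivative_at[OF this, symmetric] show ?thesis
    unfolding \<Gamma>_def by (simp add: N_simps B_simps algebra_simps flip: frame_linear_simps)
qed

text \<open>Besides \<^const>\<open>frame_curvature\<close>, the calculation produces the curvature of the flat connection of
the chart, expressed through \<open>B\<close>; it is zero by \<open>B_flat\<close>.\<close>

lemma curvature_frame:
  assumes "p \<in> U"
  shows "riemann_curvature frame_metric (\<lambda>_. u) (\<lambda>_. v) (\<lambda>_. z) p =
    E p (frame_curvature p (\<Theta> p u) (\<Theta> p v) (\<Theta> p z))"
proof -
  have nabla: "levi_civita frame_metric (\<lambda>_. v) (\<lambda>_. z) = (\<lambda>q. christoffel frame_metric q v z)" for v z
    by (simp add: levi_civita_def fun_eq_iff)
  have "lie_bracket (\<lambda>_. u) (\<lambda>_. v) = (\<lambda>_. 0)"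
    by (simp add: lie_bracket_def fun_eq_iff)
  moreover have "christoffel frame_metric p 0 z = 0"
    by (simp add: christoffel_frame assms linear_0[OF linear_coframe] linear_0[OF linear_frame]
      bilinear_lzero[OF bilinear_N] bilinear_lzero[OF bilinear_B])
  ultimately have "riemann_curvature frame_metric (\<lambda>_. u) (\<lambda>_. v) (\<lambda>_. z) p =
      frechet_derivative (\<lambda>q. christoffel frame_metric q v z) (at p) u
      + christoffel frame_metric p u (christoffel frame_metric p v z)
      - (frechet_derivative (\<lambda>q. christoffel frame_metric q u z) (at p) v
      + christoffel frame_metric p v (christoffel frame_metric p u z))"
    unfolding riemann_curvature_def nabla by (simp add: levi_civita_def)
  also have "\<dots> = E p (frame_curvature p (\<Theta> p u) (\<Theta> p v) (\<Theta> p z)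
      + (B (B (\<Theta> p u) (\<Theta> p v) - B (\<Theta> p v) (\<Theta> p u)) (\<Theta> p z)
         - (B (\<Theta> p u) (B (\<Theta> p v) (\<Theta> p z)) - B (\<Theta> p v) (B (\<Theta> p u) (\<Theta> p z)))))"
    unfolding christoffel_field_derivative[OF assms] christoffel_frame[OF assms] coframe_frame
      frame_curvature_def
    by (simp add: N_simps B_simps algebra_simps flip: frame_linear_simps)
  finally show ?thesis
    by (simp add: B_flat)
qed

lemma linear_frame_curvature: "linear (\<lambda>x. frame_curvature p x y z)"
proof -
  have N1: "linear (\<lambda>x. N p x z)" "linear (\<lambda>x. N p x y)" and N2: "linear (N p x)"
    and B1: "linear (\<lambda>x. B x y)" and B2: "linear (B x)" for x y z
    using bilinear_N[of p] bilinear_B by (auto simp: bilinear_def)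
  show ?thesis
    unfolding frame_curvature_def
    by (intro linear_compose_sub linear_compose_add linear_N'1 linear_N'2 N1 B1 B2
        linear_compose[OF N1(1) N2, unfolded o_def]
        linear_compose[OF _ N1(1), unfolded o_def])
qed

lemma ricci_frame:
  assumes "p \<in> U"
  shows "ricci frame_metric p u v =
    (\<Sum>b\<in>Basis. frame_curvature p b (\<Theta> p u) (\<Theta> p v) \<bullet> b)"
proof -
  have "linear (\<lambda>e. frame_curvature p (\<Theta> p e) (\<Theta> p u) (\<Theta> p v))"
    by (rule linear_compose[OF linear_coframe linear_frame_curvature, unfolded o_def])
  from trace_conjugate[OF linear_frame this] show ?thesis
    by (simp add: ricci_def curvature_frame assms coframe_frame)
qed

end

section \<open>Smooth functions\<close>

lemma Ck_on_cong:
  assumes "open S" "\<And>x. x \<in> S \<Longrightarrow> f x = g x" "Ck_on k S f"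
  shows "Ck_on k S g"
  using assms(2,3)
proof (induction k arbitrary: f g)
  case 0
  then show ?case
    by (auto cong: continuous_on_cong)
next
  case (Suc k)
  have D: "(g has_derivative frechet_derivative f (at x)) (at x)" if "x \<in> S" for x
    using Suc.prems that
    by (intro has_derivative_transform_within_open[OF iffD1[OF frechet_derivative_works] assms(1) that])
      auto
  have "Ck_on k S (\<lambda>x. frechet_derivative g (at x) v)" for v
    by (rule Suc.IH[of "\<lambda>x. frechet_derivative f (at x) v"])
      (simp_all add: Suc.prems(2)[simplified] flip: frechet_derivative_at[OF D])
  with D show ?case
    by (auto simp: differentiable_def)
qed

lemma Ck_on_SucI:
  assumes "open S" "\<And>x. x \<in> S \<Longrightarrow> (f has_derivative f' x) (at x)"
    and "\<And>v. Ck_on k S (\<lambda>x. f' x v)"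
  shows "Ck_on (Suc k) S f"
proof -
  have "Ck_on k S (\<lambda>x. frechet_derivative f (at x) v)" for v
    by (rule Ck_on_cong[OF assms(1) _ assms(3)]) (simp add: fun_cong[OF frechet_derivative_at[OF assms(2)]])
  then show ?thesis
    using assms(2) by (auto simp: differentiable_def)
qed

lemma Ck_on_Suc_derivative:
  assumes "Ck_on (Suc k) S f"
  shows "x \<in> S \<Longrightarrow> (f has_derivative frechet_derivative f (at x)) (at x)"
    and "Ck_on k S (\<lambda>x. frechet_derivative f (at x) v)"
  using assms by (auto intro: iffD1[OF frechet_derivative_works])

lemma Ck_on_Suc_imp: "Ck_on (Suc k) S f \<Longrightarrow> Ck_on k S f"
proof (induction k arbitrary: f)
  case 0
  then show ?case
    by (simp add: continuous_at_imp_continuous_on differentiable_imp_continuous_within)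
next
  case (Suc k)
  from Suc.prems Suc.IH show ?case
    unfolding Ck_on.simps(2)[of k] Ck_on.simps(2)[of "Suc k"] by blast
qed

lemma Ck_on_add:
  "open S \<Longrightarrow> Ck_on k S f \<Longrightarrow> Ck_on k S g \<Longrightarrow> Ck_on k S (\<lambda>x. f x + g x)"
proof (induction k arbitrary: f g)
  case 0
  then show ?case
    by (auto intro: continuous_on_add)
next
  case (Suc k)
  note f = Ck_on_Suc_derivative[OF Suc.prems(2)] and g = Ck_on_Suc_derivative[OF Suc.prems(3)]
  show ?case
    by (rule Ck_on_SucI[OF \<open>open S\<close> has_derivative_add[OF f(1) g(1)]])
      (use Suc.IH[OF \<open>open S\<close> f(2) g(2)] in auto)
qed

lemma Ck_on_bounded_linear:
  assumes "bounded_linear L" "open S"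
  shows "Ck_on k S f \<Longrightarrow> Ck_on k S (\<lambda>x. L (f x))"
proof (induction k arbitrary: f)
  case 0
  then show ?case
    using assms(1) by (auto intro: bounded_linear.continuous_on)
next
  case (Suc k)
  note f = Ck_on_Suc_derivative[OF Suc.prems]
  show ?case
    by (rule Ck_on_SucI[OF assms(2) bounded_linear.has_derivative[OF assms(1) f(1)]])
      (use Suc.IH[OF f(2)] in auto)
qed

lemma Ck_on_bounded_bilinear:
  assumes "bounded_bilinear mul" "open S"
  shows "Ck_on k S f \<Longrightarrow> Ck_on k S g \<Longrightarrow> Ck_on k S (\<lambda>x. mul (f x) (g x))"
proof (induction k arbitrary: f g)
  case 0
  then show ?case
    using assms(1) by (auto intro: bounded_bilinear.continuous_on)
next
  case (Suc k)
  note f = Ck_on_Suc_derivative[OF Suc.prems(1)] and g = Ck_on_Suc_derivative[OF Suc.prems(2)]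
  show ?case
    by (rule Ck_on_SucI[OF assms(2) bounded_bilinear.FDERIV[OF assms(1) f(1) g(1)]])
      (use Ck_on_add[OF assms(2) Suc.IH[OF Ck_on_Suc_imp[OF Suc.prems(1)] g(2)]
         Suc.IH[OF f(2) Ck_on_Suc_imp[OF Suc.prems(2)]]] in auto)
qed

lemma Ck_on_compose_linear:
  assumes "bounded_linear L" "open S" "L ` S \<subseteq> T"
  shows "Ck_on k T f \<Longrightarrow> Ck_on k S (\<lambda>x. f (L x))"
proof (induction k arbitrary: f)
  case 0
  then show ?case
    using assms by (auto intro: continuous_on_compose2 linear_continuous_on)
next
  case (Suc k)
  note f = Ck_on_Suc_derivative[OF Suc.prems]
  have "((\<lambda>x. f (L x)) has_derivative (\<lambda>v. frechet_derivative f (at (L x)) (L v))) (at x)"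
    if "x \<in> S" for x
    using has_derivative_compose[OF bounded_linear_imp_has_derivative[OF assms(1)] f(1)] that assms(3)
    by auto
  from Ck_on_SucI[OF assms(2) this] show ?case
    using Suc.IH[OF f(2)] by auto
qed

lemma smooth_on_add:
  "open S \<Longrightarrow> smooth_on S f \<Longrightarrow> smooth_on S g \<Longrightarrow> smooth_on S (\<lambda>x. f x + g x)"
  by (simp add: smooth_on_def Ck_on_add)

lemma smooth_on_diff:
  fixes f g :: "'a::real_normed_vector \<Rightarrow> 'b::real_normed_vector"
  shows "open S \<Longrightarrow> smooth_on S f \<Longrightarrow> smooth_on S g \<Longrightarrow> smooth_on S (\<lambda>x. f x - g x)"
  using Ck_on_add[of S _ f "\<lambda>x. - g x"] Ck_on_bounded_linear[of uminus S _ g]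
  by (simp add: smooth_on_def bounded_linear_minus[OF bounded_linear_ident])

lemma smooth_on_mult:
  fixes f g :: "'a::real_normed_vector \<Rightarrow> real"
  shows "open S \<Longrightarrow> smooth_on S f \<Longrightarrow> smooth_on S g \<Longrightarrow> smooth_on S (\<lambda>x. f x * g x)"
  by (simp add: smooth_on_def Ck_on_bounded_bilinear[OF bounded_bilinear_mult])

text \<open>The derivative of the coframe is a quadratic expression in the coframe itself, so each degree of
differentiability gives the next one.\<close>

lemma smooth_on_coframe:
  fixes \<Theta> :: "'a::euclidean_space \<Rightarrow> 'a \<Rightarrow> 'b::euclidean_space"
  assumes "open S" "bilinear B"
    and "\<And>p v. p \<in> S \<Longrightarrow> ((\<lambda>q. \<Theta> q v) has_derivative (\<lambda>u. - B (\<Theta> p u) (\<Theta> p v))) (at p)"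
  shows "smooth_on S (\<lambda>p. \<Theta> p v)"
proof -
  have "Ck_on k S (\<lambda>p. \<Theta> p v)" for k v
  proof (induction k arbitrary: v)
    case 0
    show ?case
      unfolding Ck_on.simps
      by (rule continuous_at_imp_continuous_on) (blast intro: has_derivative_continuous[OF assms(3)])
  next
    case (Suc k)
    have "Ck_on k S (\<lambda>p. - B (\<Theta> p u) (\<Theta> p v))" for u
      by (rule Ck_on_bounded_linear[OF bounded_linear_minus[OF bounded_linear_ident] assms(1)
            Ck_on_bounded_bilinear[OF _ assms(1) Suc Suc]])
        (use assms(2) in \<open>simp add: bilinear_conv_bounded_bilinear\<close>)
    with assms(3) show ?case
      by (intro Ck_on_SucI[OF assms(1)])
  qed
  then show ?thesis
    by (simp add: smooth_on_def)
qed

section \<open>Left-invariant frames on \<open>E(1,1)\<close>\<close>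

text \<open>The differential of left translation by an element with boost parameter \<open>s\<close>; it does not depend
on the point of \<open>e11\<close> at which it is taken, since left translations are affine in the chart.\<close>

definition push :: "real \<Rightarrow> e11 \<Rightarrow> e11" where
  "push s v = (boost s (fst v), snd v)"

text \<open>The generator of the one-parameter group \<open>s \<mapsto> boost s\<close>, which exchanges the two translation
coordinates, extended by zero.\<close>

definition infinitesimal_boost :: "e11 \<Rightarrow> e11" where
  "infinitesimal_boost v = (prod.swap (fst v), 0)"

lemma linear_push: "linear (push s)"
  by (auto simp: push_def boost_def algebra_simps intro!: linearI)

lemma linear_infinitesimal_boost: "linear infinitesimal_boost"
  by (auto simp: infinitesimal_boost_def intro!: linearI)

lemma push_infinitesimal_boost: "push s (infinitesimal_boost v) = infinitesimal_boost (push s v)"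
  by (simp add: push_def infinitesimal_boost_def boost_def)

lemma push_inverse: "push (- s) (push s v) = v"
proof -
  have "cosh s * cosh s = 1 + sinh s * sinh s"
    using hyperbolic_pythagoras[of s] by (simp add: power2_eq_square)
  then have "cosh s * (cosh s * x) = x + sinh s * (sinh s * x)" for x
    by (simp only: mult.assoc[symmetric] distrib_right mult_1_left)
  then show ?thesis
    by (cases v) (auto simp: push_def boost_def algebra_simps)
qed

lemma cosh_derivative: "(cosh has_real_derivative sinh s) (at s)"
  and sinh_derivative: "(sinh has_real_derivative cosh s) (at s)"
  by (auto intro!: derivative_eq_intros)

lemma push_derivative:
  "((\<lambda>q. push (snd q) v) has_derivative
      (\<lambda>u. snd u *\<^sub>R infinitesimal_boost (push (snd p) v))) (at p)"
  for p :: e11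
  unfolding push_def boost_def infinitesimal_boost_def
  by (auto intro!: derivative_eq_intros DERIV_compose_FDERIV[OF cosh_derivative]
      DERIV_compose_FDERIV[OF sinh_derivative] simp: algebra_simps)

lemma push_minus_derivative:
  "((\<lambda>q. push (- snd q) v) has_derivative
      (\<lambda>u. - snd u *\<^sub>R infinitesimal_boost (push (- snd p) v))) (at p)"
  for p :: e11
  unfolding push_def boost_def infinitesimal_boost_def
  by (auto intro!: derivative_eq_intros DERIV_compose_FDERIV[OF cosh_derivative]
      DERIV_compose_FDERIV[OF sinh_derivative] simp: algebra_simps)

lemma e11_mult_derivative: "(e11_mult p has_derivative push (snd p)) (at q)"
  unfolding e11_mult_def push_def boost_def
  by (auto intro!: derivative_eq_intros simp: algebra_simps)

lemma left_invariant_push: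
  assumes "left_invariant X"
  shows "X p = push (snd p) (X 0)"
proof -
  have "e11_mult p 0 = p"
    by (simp add: e11_mult_def boost_def prod_eq_iff)
  moreover have "frechet_derivative (e11_mult p) (at 0) (X 0) = X (e11_mult p 0)"
    using assms by (simp only: left_invariant_def)
  ultimately show ?thesis
    by (simp add: frechet_derivative_at[OF e11_mult_derivative, symmetric])
qed

text \<open>A left-invariant field depends on the point only through the boost parameter.\<close>

lemma left_invariant_derivative:
  assumes "left_invariant X"
  shows "(X has_derivative (\<lambda>u. snd u *\<^sub>R infinitesimal_boost (X p))) (at p)"
  using push_derivative[of "X 0" p] by (simp flip: left_invariant_push[OF assms])

lemma left_invariant_bracket:
  assumes "left_invariant X" "left_invariant Y"
  shows "lie_bracket X Y p
    = snd (X p) *\<^sub>R infinitesimal_boost (Y p) - snd (Y p) *\<^sub>R infinitesimal_boost (X p)"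
  unfolding lie_bracket_def frechet_derivative_at[OF left_invariant_derivative[OF assms(1)], symmetric]
    frechet_derivative_at[OF left_invariant_derivative[OF assms(2)], symmetric] ..

locale lorentz_frame =
  fixes F1 F2 F3 :: "e11 \<Rightarrow> e11" and \<theta>1 \<theta>2 \<theta>3 :: "e11 \<Rightarrow> e11 \<Rightarrow> real"
  assumes frame: "left_invariant_frame F1 F2 F3"
    and bracket12: "\<And>p. lie_bracket F1 F2 p = - F3 p"
    and bracket31: "\<And>p. lie_bracket F3 F1 p = 0"
    and bracket23: "\<And>p. lie_bracket F2 F3 p = F1 p"
    and coframe: "dual_coframe F1 F2 F3 \<theta>1 \<theta>2 \<theta>3"
begin

lemma left_invariants: "left_invariant F1" "left_invariant F2" "left_invariant F3"
  using frame by (auto simp: left_invariant_frame_def)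

lemma linear_coframe: "linear (\<theta>1 p)" "linear (\<theta>2 p)" "linear (\<theta>3 p)"
  using coframe by (simp_all only: dual_coframe_def)

lemmas coframe_linear_simps =
  linear_add[OF linear_coframe(1)] linear_scale[OF linear_coframe(1)]
  linear_add[OF linear_coframe(2)] linear_scale[OF linear_coframe(2)]
  linear_add[OF linear_coframe(3)] linear_scale[OF linear_coframe(3)]

lemma coframe_simps [simp]:
  "\<theta>1 p (F1 p) = 1" "\<theta>1 p (F2 p) = 0" "\<theta>1 p (F3 p) = 0"
  "\<theta>2 p (F1 p) = 0" "\<theta>2 p (F2 p) = 1" "\<theta>2 p (F3 p) = 0"
  "\<theta>3 p (F1 p) = 0" "\<theta>3 p (F2 p) = 0" "\<theta>3 p (F3 p) = 1"
  using coframe by (simp_all only: dual_coframe_def)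

lemma linear_eq_on_frame:
  assumes "linear f" "linear g" "f (F1 p) = g (F1 p)" "f (F2 p) = g (F2 p)" "f (F3 p) = g (F3 p)"
  shows "f u = g u"
proof -
  have "u \<in> span {F1 p, F2 p, F3 p}"
    using frame unfolding left_invariant_frame_def by blast
  then show ?thesis
    by (rule linear_eq_on_span[OF assms(1,2), rotated]) (use assms(3-5) in auto)
qed

lemma frame_expansion: "\<theta>1 p u *\<^sub>R F1 p + \<theta>2 p u *\<^sub>R F2 p + \<theta>3 p u *\<^sub>R F3 p = u"
proof -
  have "linear (\<lambda>u. \<theta>1 p u *\<^sub>R F1 p + \<theta>2 p u *\<^sub>R F2 p + \<theta>3 p u *\<^sub>R F3 p)"
    by (rule linearI) (simp_all add: coframe_linear_simps algebra_simps)
  from linear_eq_on_frame[OF this linear_id, of p u] show ?thesis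
    by simp
qed

text \<open>The speed at which \<open>F2\<close> changes the boost parameter.\<close>

definition rate :: real where "rate = snd (F2 0)"

text \<open>Commutators in \<open>E(1,1)\<close> are translations, and both \<open>F1\<close> and \<open>F3\<close> are commutators up to sign.\<close>

lemma snd_frame: "snd (F1 p) = 0" "snd (F2 p) = rate" "snd (F3 p) = 0"
proof -
  have J: "snd (infinitesimal_boost v) = 0" for v
    by (simp add: infinitesimal_boost_def)
  show "snd (F1 p) = 0"
    using arg_cong[OF bracket23[of p], of snd] left_invariant_bracket[OF left_invariants(2,3), of p]
    by (simp add: J)
  show "snd (F3 p) = 0"
    using arg_cong[OF bracket12[of p], of snd] left_invariant_bracket[OF left_invariants(1,2), of p]
    by (simp add: J)
  show "snd (F2 p) = rate"
    using left_invariant_push[OF left_invariants(2), of p] by (simp add: push_def rate_def)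
qed

lemma boost_F3: "rate *\<^sub>R infinitesimal_boost (F3 p) = F1 p"
  using bracket23[of p] left_invariant_bracket[OF left_invariants(2,3), of p]
  by (simp add: snd_frame)

lemma boost_F1: "rate *\<^sub>R infinitesimal_boost (F1 p) = F3 p"
  using bracket12[of p] left_invariant_bracket[OF left_invariants(1,2), of p]
  by (simp add: snd_frame)

text \<open>The infinitesimal boost is an involution on translations, and by the bracket relations its
multiple by the rate exchanges \<open>F1\<close> and \<open>F3\<close>.\<close>

lemma rate_square: "rate * rate = 1"
proof -
  have "infinitesimal_boost (infinitesimal_boost (F1 0)) = F1 0"
    using snd_frame(1)[of 0] by (simp add: infinitesimal_boost_def prod_eq_iff)
  then have "F1 0 = (rate * rate) *\<^sub>R F1 0"
    using boost_F1[of 0] boost_F3[of 0]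
    by (metis linear_scale[OF linear_infinitesimal_boost] scaleR_scaleR)
  then have "\<theta>1 0 (F1 0) = \<theta>1 0 ((rate * rate) *\<^sub>R F1 0)"
    by (rule arg_cong)
  then show ?thesis
    by (simp add: linear_scale[OF linear_coframe(1)])
qed

text \<open>The relations leave \<open>F2\<close> undetermined up to adding translations. These numbers record the
translational part of \<open>F2\<close> through its infinitesimal boost; they cancel in the curvature.\<close>

definition drift1 :: real where "drift1 = rate * \<theta>1 0 (infinitesimal_boost (F2 0))"
definition drift3 :: real where "drift3 = rate * \<theta>3 0 (infinitesimal_boost (F2 0))"

lemma snd_eq_coframe: "snd u = rate * \<theta>2 p u"
  using arg_cong[OF frame_expansion[of p u], of snd] by (simp add: snd_frame mult.commute)

lemma boost_F2: "rate *\<^sub>R infinitesimal_boost (F2 p) = drift1 *\<^sub>R F1 p + drift3 *\<^sub>R F3 p"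
proof -
  have "\<theta>2 0 (infinitesimal_boost (F2 0)) = 0"
    using snd_eq_coframe[of "infinitesimal_boost (F2 0)" 0] rate_square
    by (auto simp: infinitesimal_boost_def)
  then have "infinitesimal_boost (F2 0) = \<theta>1 0 (infinitesimal_boost (F2 0)) *\<^sub>R F1 0
      + \<theta>3 0 (infinitesimal_boost (F2 0)) *\<^sub>R F3 0"
    using frame_expansion[of 0 "infinitesimal_boost (F2 0)"] by simp
  then have "rate *\<^sub>R infinitesimal_boost (F2 0)
      = rate *\<^sub>R (\<theta>1 0 (infinitesimal_boost (F2 0)) *\<^sub>R F1 0
        + \<theta>3 0 (infinitesimal_boost (F2 0)) *\<^sub>R F3 0)"
    by (rule arg_cong)
  then have "rate *\<^sub>R infinitesimal_boost (F2 0) = drift1 *\<^sub>R F1 0 + drift3 *\<^sub>R F3 0"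
    unfolding drift1_def drift3_def scaleR_add_right scaleR_scaleR .
  from arg_cong[OF this, of "push (snd p)"] show ?thesis
    by (simp add: linear_add[OF linear_push] linear_scale[OF linear_push] push_infinitesimal_boost
        flip: left_invariant_push[OF left_invariants(1)] left_invariant_push[OF left_invariants(2)]
          left_invariant_push[OF left_invariants(3)])
qed

lemma frame_derivatives:
  "(F1 has_derivative (\<lambda>u. \<theta>2 p u *\<^sub>R F3 p)) (at p)"
  "(F2 has_derivative (\<lambda>u. \<theta>2 p u *\<^sub>R (drift1 *\<^sub>R F1 p + drift3 *\<^sub>R F3 p))) (at p)"
  "(F3 has_derivative (\<lambda>u. \<theta>2 p u *\<^sub>R F1 p)) (at p)"
proof -
  have scale: "snd u *\<^sub>R v = \<theta>2 p u *\<^sub>R (rate *\<^sub>R v)" for u v :: e11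
    unfolding scaleR_scaleR snd_eq_coframe[of u p] by (simp only: mult.commute)
  show "(F1 has_derivative (\<lambda>u. \<theta>2 p u *\<^sub>R F3 p)) (at p)"
    using left_invariant_derivative[OF left_invariants(1), of p] unfolding scale boost_F1 .
  show "(F2 has_derivative (\<lambda>u. \<theta>2 p u *\<^sub>R (drift1 *\<^sub>R F1 p + drift3 *\<^sub>R F3 p))) (at p)"
    using left_invariant_derivative[OF left_invariants(2), of p] unfolding scale boost_F2 .
  show "(F3 has_derivative (\<lambda>u. \<theta>2 p u *\<^sub>R F1 p)) (at p)"
    using left_invariant_derivative[OF left_invariants(3), of p] unfolding scale boost_F3 .
qed

text \<open>The coframe is left-invariant as well: the right-hand sides are dual to the frame at \<open>p\<close>, because
the frame is transported by \<^const>\<open>push\<close>.\<close>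

lemma coframe_push: "\<theta>1 p u = \<theta>1 0 (push (- snd p) u)" "\<theta>2 p u = \<theta>2 0 (push (- snd p) u)"
  "\<theta>3 p u = \<theta>3 0 (push (- snd p) u)"
proof -
  have F: "push (- snd p) (F1 p) = F1 0" "push (- snd p) (F2 p) = F2 0" "push (- snd p) (F3 p) = F3 0"
    using left_invariants[THEN left_invariant_push, of p] by (simp_all only: push_inverse)
  show "\<theta>1 p u = \<theta>1 0 (push (- snd p) u)"
    by (rule linear_eq_on_frame[where p = p, OF linear_coframe(1)
        linear_compose[OF linear_push linear_coframe(1), unfolded o_def]]) (simp_all add: F)
  show "\<theta>2 p u = \<theta>2 0 (push (- snd p) u)"
    by (rule linear_eq_on_frame[where p = p, OF linear_coframe(2)
        linear_compose[OF linear_push linear_coframe(2), unfolded o_def]]) (simp_all add: F)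
  show "\<theta>3 p u = \<theta>3 0 (push (- snd p) u)"
    by (rule linear_eq_on_frame[where p = p, OF linear_coframe(3)
        linear_compose[OF linear_push linear_coframe(3), unfolded o_def]]) (simp_all add: F)
qed

lemma coframe_derivatives:
  "((\<lambda>q. \<theta>1 q v) has_derivative (\<lambda>u. - (\<theta>2 p u * (\<theta>3 p v + drift1 * \<theta>2 p v)))) (at p)"
  "((\<lambda>q. \<theta>2 q v) has_derivative (\<lambda>u. 0)) (at p)"
  "((\<lambda>q. \<theta>3 q v) has_derivative (\<lambda>u. - (\<theta>2 p u * (\<theta>1 p v + drift3 * \<theta>2 p v)))) (at p)"
proof -
  define w where "w = push (- snd p) v"
  have theta: "\<theta>1 p v = \<theta>1 0 w" "\<theta>2 p v = \<theta>2 0 w" "\<theta>3 p v = \<theta>3 0 w"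
    unfolding w_def by (fact coframe_push)+
  note lin = linear_add[OF linear_infinitesimal_boost] linear_scale[OF linear_infinitesimal_boost]
  have "rate *\<^sub>R infinitesimal_boost w = rate *\<^sub>R infinitesimal_boost
      (\<theta>1 0 w *\<^sub>R F1 0 + \<theta>2 0 w *\<^sub>R F2 0 + \<theta>3 0 w *\<^sub>R F3 0)"
    by (simp add: frame_expansion)
  also have "\<dots> = \<theta>1 0 w *\<^sub>R (rate *\<^sub>R infinitesimal_boost (F1 0))
      + \<theta>2 0 w *\<^sub>R (rate *\<^sub>R infinitesimal_boost (F2 0))
      + \<theta>3 0 w *\<^sub>R (rate *\<^sub>R infinitesimal_boost (F3 0))"
    by (simp add: lin scaleR_add_right mult.commute)
  finally have J: "rate *\<^sub>R infinitesimal_boost w = \<theta>1 0 w *\<^sub>R F3 0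
      + \<theta>2 0 w *\<^sub>R (drift1 *\<^sub>R F1 0 + drift3 *\<^sub>R F3 0) + \<theta>3 0 w *\<^sub>R F1 0"
    unfolding boost_F1 boost_F2 boost_F3 .
  have D: "((\<lambda>q. f (push (- snd q) v)) has_derivative
      (\<lambda>u. - (\<theta>2 p u * f (rate *\<^sub>R infinitesimal_boost w)))) (at p)" if "linear f" for f :: "e11 \<Rightarrow> real"
  proof -
    have "((\<lambda>q. f (push (- snd q) v)) has_derivative
        (\<lambda>u. f (- snd u *\<^sub>R infinitesimal_boost w))) (at p)"
      unfolding w_def
      by (rule bounded_linear.has_derivative[OF that[unfolded linear_conv_bounded_linear]
            push_minus_derivative])
    moreover have "f (- snd u *\<^sub>R infinitesimal_boost w)
        = - (\<theta>2 p u * f (rate *\<^sub>R infinitesimal_boost w))" for u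
      by (simp only: linear_scale[OF that] snd_eq_coframe[of u p]) simp
    ultimately show ?thesis
      by simp
  qed
  show "((\<lambda>q. \<theta>1 q v) has_derivative (\<lambda>u. - (\<theta>2 p u * (\<theta>3 p v + drift1 * \<theta>2 p v)))) (at p)"
    using D[OF linear_coframe(1), of 0] unfolding coframe_push(1)[of _ v, symmetric]
    by (simp add: J coframe_linear_simps theta algebra_simps)
  show "((\<lambda>q. \<theta>2 q v) has_derivative (\<lambda>u. 0)) (at p)"
    using D[OF linear_coframe(2), of 0] unfolding coframe_push(2)[of _ v, symmetric]
    by (simp add: J coframe_linear_simps)
  show "((\<lambda>q. \<theta>3 q v) has_derivative (\<lambda>u. - (\<theta>2 p u * (\<theta>1 p v + drift3 * \<theta>2 p v)))) (at p)"
    using D[OF linear_coframe(3), of 0] unfolding coframe_push(3)[of _ v, symmetric]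
    by (simp add: J coframe_linear_simps theta algebra_simps)
qed

end

section \<open>Algebra of the flow metric\<close>

text \<open>Coefficients of a tangent vector of \<open>\<real> \<times> E(1,1)\<close> in the frame \<open>\<partial>\<^sub>t, F1, F2, F3\<close>.\<close>

type_synonym quad = "real \<times> real \<times> real \<times> real"

text \<open>Along a solution this is the logarithmic derivative of \<open>a\<close> and minus that of \<open>c\<close>, so that the
product \<open>a c\<close> is constant.\<close>

definition shear :: "real \<Rightarrow> real \<Rightarrow> real \<Rightarrow> real" where
  "shear a b c = (c\<^sup>2 - a\<^sup>2) / (2 * a * b * c)"

text \<open>Along a solution this is the logarithmic derivative of \<open>b\<close>, hence also of the volume factor
\<open>a b c\<close>.\<close>

definition expansion :: "real \<Rightarrow> real \<Rightarrow> real \<Rightarrow> real" where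
  "expansion a b c = (c + a)\<^sup>2 / (2 * a * b * c)"

definition flow_solution ::
    "real set \<Rightarrow> (real \<Rightarrow> real) \<Rightarrow> (real \<Rightarrow> real) \<Rightarrow> (real \<Rightarrow> real) \<Rightarrow> bool" where
  "flow_solution I a b c \<longleftrightarrow> (\<forall>t\<in>I. a t \<noteq> 0 \<and> b t \<noteq> 0 \<and> c t \<noteq> 0 \<and>
     (a has_real_derivative a t * shear (a t) (b t) (c t)) (at t) \<and>
     (b has_real_derivative b t * expansion (a t) (b t) (c t)) (at t) \<and>
     (c has_real_derivative - c t * shear (a t) (b t) (c t)) (at t))"

definition shear_rate :: "real \<Rightarrow> real \<Rightarrow> real \<Rightarrow> real" where
  "shear_rate a b c = - shear a b c * (expansion a b c + (a\<^sup>2 + c\<^sup>2) / (a * b * c))"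

definition expansion_rate :: "real \<Rightarrow> real \<Rightarrow> real \<Rightarrow> real" where
  "expansion_rate a b c = - 2 * (shear a b c)\<^sup>2 - (expansion a b c)\<^sup>2"

text \<open>Up to sign, the symmetric part of the connection coefficients that come from the brackets of the
frame. The third argument is one of
\<open>a\<close>, \<open>b\<close>, \<open>c\<close>, the length of the frame field in whose direction the covariant derivative points.\<close>

definition twist :: "real \<Rightarrow> real \<Rightarrow> real \<Rightarrow> real" where
  "twist a c x = (c\<^sup>2 - a\<^sup>2) / (2 * x\<^sup>2)"

text \<open>The derivative of \<^const>\<open>twist\<close> when \<open>a\<close>, \<open>c\<close> and \<open>x\<close> have logarithmic derivatives \<open>k\<close>, \<open>- k\<close>
and \<open>l\<close>.\<close>

definition twist_rate :: "real \<Rightarrow> real \<Rightarrow> real \<Rightarrow> real \<Rightarrow> real \<Rightarrow> real" where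
  "twist_rate k l a c x = - k * (a\<^sup>2 + c\<^sup>2) / x\<^sup>2 - 2 * l * twist a c x"

definition flow_form :: "real \<Rightarrow> real \<Rightarrow> real \<Rightarrow> quad \<Rightarrow> quad \<Rightarrow> real" where
  "flow_form a b c = (\<lambda>(u0, u1, u2, u3) (v0, v1, v2, v3).
     u0 * v0 + a\<^sup>2 * (u1 * v1) - b\<^sup>2 * (u2 * v2) - c\<^sup>2 * (u3 * v3))"

text \<open>The derivative of the frame in the chart: moving along \<open>F2\<close> exchanges \<open>F1\<close> and \<open>F3\<close>, and turns
\<open>F2\<close> into \<open>r F1 + s F3\<close>, where \<open>r\<close>, \<open>s\<close> depend on the choice of \<open>F2\<close>. Moving along the other fields
changes nothing.\<close>

definition frame_product :: "real \<Rightarrow> real \<Rightarrow> quad \<Rightarrow> quad \<Rightarrow> quad" where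
  "frame_product r s = (\<lambda>(u0, u1, u2, u3) (v0, v1, v2, v3).
     (0, u2 * (v3 + r * v2), 0, u2 * (v1 + s * v2)))"

text \<open>The Levi-Civita connection in the frame, found from the Koszul formula. The terms \<open>u2 * v3\<close> and
\<open>u2 * v1\<close> outside the symmetric expressions supply the brackets.\<close>

definition flow_connection :: "real \<Rightarrow> real \<Rightarrow> real \<Rightarrow> quad \<Rightarrow> quad \<Rightarrow> quad" where
  "flow_connection a b c = (\<lambda>(u0, u1, u2, u3) (v0, v1, v2, v3).
    (let k = shear a b c; m = expansion a b c in
     (- a\<^sup>2 * k * (u1 * v1) + b\<^sup>2 * m * (u2 * v2) - c\<^sup>2 * k * (u3 * v3),
      k * (u0 * v1 + u1 * v0) + twist a c a * (u2 * v3 + u3 * v2) + u2 * v3,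
      m * (u0 * v2 + u2 * v0) + twist a c b * (u1 * v3 + u3 * v1),
      - k * (u0 * v3 + u3 * v0) - twist a c c * (u1 * v2 + u2 * v1) + u2 * v1)))"

text \<open>The \<open>t\<close>-derivative of \<^const>\<open>flow_connection\<close> along a solution.\<close>

definition flow_connection_rate :: "real \<Rightarrow> real \<Rightarrow> real \<Rightarrow> quad \<Rightarrow> quad \<Rightarrow> quad" where
  "flow_connection_rate a b c = (\<lambda>(u0, u1, u2, u3) (v0, v1, v2, v3).
    (let k = shear a b c; m = expansion a b c; k' = shear_rate a b c; m' = expansion_rate a b c in
     (- a\<^sup>2 * (k' + 2 * k\<^sup>2) * (u1 * v1) + b\<^sup>2 * (m' + 2 * m\<^sup>2) * (u2 * v2)
        - c\<^sup>2 * (k' - 2 * k\<^sup>2) * (u3 * v3),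
      k' * (u0 * v1 + u1 * v0) + twist_rate k k a c a * (u2 * v3 + u3 * v2),
      m' * (u0 * v2 + u2 * v0) + twist_rate k m a c b * (u1 * v3 + u3 * v1),
      - k' * (u0 * v3 + u3 * v0) - twist_rate k (- k) a c c * (u1 * v2 + u2 * v1))))"

lemma bilinear_flow_form: "bilinear (flow_form a b c)"
  by (auto simp: bilinear_def flow_form_def algebra_simps intro!: linearI)

lemma bilinear_frame_product: "bilinear (frame_product r s)"
  by (auto simp: bilinear_def frame_product_def algebra_simps intro!: linearI)

lemma bilinear_flow_connection: "bilinear (flow_connection a b c)"
  by (auto simp: bilinear_def flow_connection_def Let_def algebra_simps intro!: linearI)

lemma bilinear_flow_connection_rate: "bilinear (flow_connection_rate a b c)"
  by (auto simp: bilinear_def flow_connection_rate_def Let_def algebra_simps intro!: linearI)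

lemma flow_form_commute: "flow_form a b c x y = flow_form a b c y x"
  by (cases x; cases y) (simp add: flow_form_def mult.commute)

lemma flow_form_nondegenerate:
  assumes "a \<noteq> 0" "b \<noteq> 0" "c \<noteq> 0" and orth: "\<And>y. flow_form a b c x y = 0"
  shows "x = 0"
  using assms(1-3) orth[of "(1, 0, 0, 0)"] orth[of "(0, 1, 0, 0)"] orth[of "(0, 0, 1, 0)"]
    orth[of "(0, 0, 0, 1)"]
  by (cases x) (simp add: flow_form_def zero_prod_def)

lemma frame_product_flat:
  "frame_product r s x (frame_product r s y z) - frame_product r s y (frame_product r s x z)
   = frame_product r s (frame_product r s x y - frame_product r s y x) z"
  by (cases x; cases y; cases z) (simp add: frame_product_def)

lemma flow_connection_torsion_free:
  "flow_connection a b c x y - flow_connection a b c y x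
   = frame_product r s x y - frame_product r s y x"
  by (cases x; cases y) (simp add: frame_product_def flow_connection_def Let_def algebra_simps)

lemma flow_connection_metric:
  assumes "a \<noteq> 0" "b \<noteq> 0" "c \<noteq> 0"
  shows "flow_form a b c (flow_connection a b c w (x0, x1, x2, x3)) (y0, y1, y2, y3)
       + flow_form a b c (x0, x1, x2, x3) (flow_connection a b c w (y0, y1, y2, y3))
     = fst w * (2 * shear a b c * (a\<^sup>2 * (x1 * y1) + c\<^sup>2 * (x3 * y3))
       - 2 * expansion a b c * b\<^sup>2 * (x2 * y2))"
  using assms
  by (cases w) (simp add: flow_form_def flow_connection_def Let_def twist_def field_simps)

lemma shear_derivative:
  assumes "flow_solution I a b c" "t \<in> I"
  shows "((\<lambda>t. shear (a t) (b t) (c t)) has_real_derivative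
           shear_rate (a t) (b t) (c t)) (at t)"
  using bspec[OF assms[unfolded flow_solution_def]]
  unfolding shear_def expansion_def shear_rate_def
  by (auto intro!: derivative_eq_intros) (simp add: field_simps power2_eq_square)

lemma expansion_derivative:
  assumes "flow_solution I a b c" "t \<in> I"
  shows "((\<lambda>t. expansion (a t) (b t) (c t)) has_real_derivative
           expansion_rate (a t) (b t) (c t)) (at t)"
  using bspec[OF assms[unfolded flow_solution_def]]
  unfolding shear_def expansion_def expansion_rate_def
  by (auto intro!: derivative_eq_intros) (simp add: field_simps power2_eq_square)

lemma twist_derivative:
  assumes "(a has_real_derivative a t * k) (at t)" "(c has_real_derivative - c t * k) (at t)"
    and "(x has_real_derivative x t * l) (at t)" "x t \<noteq> 0"
  shows "((\<lambda>t. twist (a t) (c t) (x t)) has_real_derivative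
           twist_rate k l (a t) (c t) (x t)) (at t)"
  unfolding twist_def twist_rate_def using assms
  by (auto intro!: derivative_eq_intros) (simp add: field_simps eval_nat_numeral)

lemma flow_connection_derivative:
  assumes "flow_solution I a b c" "t \<in> I"
  shows "((\<lambda>t. flow_connection (a t) (b t) (c t) x y) has_vector_derivative
           flow_connection_rate (a t) (b t) (c t) x y) (at t)"
proof -
  have nz: "a t \<noteq> 0" "b t \<noteq> 0" "c t \<noteq> 0"
    and a: "(a has_real_derivative a t * shear (a t) (b t) (c t)) (at t)"
    and b: "(b has_real_derivative b t * expansion (a t) (b t) (c t)) (at t)"
    and c: "(c has_real_derivative - c t * shear (a t) (b t) (c t)) (at t)"
    using assms unfolding flow_solution_def by blast+
  have c': "(c has_real_derivative c t * - shear (a t) (b t) (c t)) (at t)"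
    using c by simp
  note D = a b c shear_derivative[OF assms] expansion_derivative[OF assms]
    twist_derivative[OF a c a nz(1)] twist_derivative[OF a c b nz(2)]
    twist_derivative[OF a c c' nz(3)]
  obtain x0 x1 x2 x3 y0 y1 y2 y3 where xy: "x = (x0, x1, x2, x3)" "y = (y0, y1, y2, y3)"
    by (cases x; cases y) auto
  show ?thesis
    unfolding xy flow_connection_def flow_connection_rate_def Let_def prod.case
    by (intro has_vector_derivative_Pair;
        unfold has_real_derivative_iff_has_vector_derivative[symmetric])
      (rule derivative_eq_intros refl D | simp add: algebra_simps power2_eq_square)+
qed

text \<open>Metric compatibility of the connection. Only the \<open>\<partial>\<^sub>t\<close>-component of the direction \<open>w\<close>
differentiates the coefficients, which are functions of \<open>t\<close>.\<close>

lemma flow_form_derivative: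
  assumes "flow_solution I a b c" "t \<in> I"
  obtains d where "((\<lambda>t. flow_form (a t) (b t) (c t) x y) has_real_derivative d) (at t)"
    and "\<And>w. fst w * d =
       flow_form (a t) (b t) (c t) (flow_connection (a t) (b t) (c t) w x) y
       + flow_form (a t) (b t) (c t) x (flow_connection (a t) (b t) (c t) w y)"
proof -
  have nz: "a t \<noteq> 0" "b t \<noteq> 0" "c t \<noteq> 0"
    and D: "(a has_real_derivative a t * shear (a t) (b t) (c t)) (at t)"
      "(b has_real_derivative b t * expansion (a t) (b t) (c t)) (at t)"
      "(c has_real_derivative - c t * shear (a t) (b t) (c t)) (at t)"
    using assms unfolding flow_solution_def by blast+
  obtain x0 x1 x2 x3 y0 y1 y2 y3 where xy: "x = (x0, x1, x2, x3)" "y = (y0, y1, y2, y3)"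
    by (cases x; cases y) auto
  have deriv: "((\<lambda>t. flow_form (a t) (b t) (c t) x y) has_real_derivative
      2 * shear (a t) (b t) (c t) * ((a t)\<^sup>2 * (x1 * y1) + (c t)\<^sup>2 * (x3 * y3))
      - 2 * expansion (a t) (b t) (c t) * (b t)\<^sup>2 * (x2 * y2)) (at t)"
    unfolding xy flow_form_def prod.case
    by (rule derivative_eq_intros refl D | simp add: field_simps power2_eq_square)+
  show ?thesis
    by (rule that[OF deriv]) (simp add: xy flow_connection_metric[OF nz])
qed

lemma sum_Basis_quad:
  "(\<Sum>x\<in>Basis. f x) = f (1, 0, 0, 0) + f (0, 1, 0, 0) + f (0, 0, 1, 0) + f ((0, 0, 0, 1) :: quad)"
proof -
  have "Basis = {(1, 0, 0, 0), (0, 1, 0, 0), (0, 0, 1, 0), (0, 0, 0, 1) :: quad}"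
    by (auto simp: Basis_prod_def zero_prod_def)
  then have "(\<Sum>x\<in>Basis. f x)
      = (\<Sum>x\<in>{(1, 0, 0, 0), (0, 1, 0, 0), (0, 0, 1, 0), (0, 0, 0, 1)}. f x)"
    by (rule arg_cong)
  then show ?thesis
    by (simp add: add.assoc)
qed

text \<open>The summand is the curvature of the flow connection, and its trace is the Ricci form in frame
coordinates. The off-diagonal terms cancel identically. Of the diagonal ones, the first is zero
by the derivative of the expansion; the others say that the extrinsic terms, which carry \<open>k'\<close> and
\<open>m'\<close>, balance the Ricci tensor of the left-invariant metric on the slice, whose entries are
quadratic polynomials in the twists.\<close>

lemma flow_curvature_trace:
  fixes a b c r s :: real
  assumes nz: "a \<noteq> 0" "b \<noteq> 0" "c \<noteq> 0"
  defines "N \<equiv> flow_connection a b c" and "N' \<equiv> flow_connection_rate a b c"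
    and "B \<equiv> frame_product r s"
  shows "(\<Sum>x\<in>Basis. (fst x *\<^sub>R N' y z - fst y *\<^sub>R N' x z + N x (N y z) - N y (N x z)
            - N (B x y - B y x) z) \<bullet> x) = 0" (is "?trace = 0")
proof -
  obtain y0 y1 y2 y3 z0 z1 z2 z3 where yz: "y = (y0, y1, y2, y3)" "z = (z0, z1, z2, z3)"
    by (cases y; cases z) auto
  define k m k' m' where "k = shear a b c" "m = expansion a b c"
    and "k' = shear_rate a b c" "m' = expansion_rate a b c"
  note km = this
  define P Q S where "P = twist a c a" "Q = twist a c b" "S = twist a c c"
  note PQS = this
  have "?trace = - (m' + m\<^sup>2 + 2 * k\<^sup>2) * (y0 * z0)
      - (a\<^sup>2 * (k' + k * m) + 2 * Q * (1 - S)) * (y1 * z1)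
      + (b\<^sup>2 * (m' + m\<^sup>2) + 2 * P * S) * (y2 * z2)
      - (c\<^sup>2 * (k' + k * m) + 2 * Q * (1 + P)) * (y3 * z3)"
    unfolding yz sum_Basis_quad N_def N'_def B_def
    by (simp add: zero_prod_def flow_connection_def flow_connection_rate_def frame_product_def Let_def
        flip: km PQS) (simp add: algebra_simps power2_eq_square)
  moreover have "m' + m\<^sup>2 + 2 * k\<^sup>2 = 0"
    by (simp add: km expansion_rate_def)
  moreover have "a\<^sup>2 * (k' + k * m) + 2 * Q * (1 - S) = 0" "c\<^sup>2 * (k' + k * m) + 2 * Q * (1 + P) = 0"
    using nz by (simp_all add: km PQS shear_rate_def shear_def twist_def field_simps power2_eq_square)
  moreover have "b\<^sup>2 * (m' + m\<^sup>2) + 2 * P * S = 0"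
    using nz by (simp add: km PQS expansion_rate_def shear_def twist_def field_simps power2_eq_square)
  ultimately show ?thesis
    by simp
qed

section \<open>Signature\<close>

lemma has_signature_pullback:
  fixes T :: "'a::euclidean_space \<Rightarrow> 'b::euclidean_space" and F :: "'b \<Rightarrow> 'a"
  assumes "has_signature B r s" "linear F" "\<And>x. T (F x) = x" "\<And>u. F (T u) = u"
  shows "has_signature (\<lambda>u v. B (T u) (T v)) r s"
proof -
  obtain P N where PN: "finite P" "finite N" "card P = r" "card N = s" "P \<inter> N = {}"
      "independent (P \<union> N)" "span (P \<union> N) = UNIV" "\<forall>u\<in>P. B u u = 1" "\<forall>u\<in>N. B u u = -1"
      "\<forall>u\<in>P \<union> N. \<forall>v\<in>P \<union> N. u \<noteq> v \<longrightarrow> B u v = 0"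
    using assms(1) unfolding has_signature_def by blast
  have inj: "inj F"
    by (metis assms(3) injI)
  have surj: "range F = UNIV"
    by (metis assms(4) surjI)
  have "independent (F ` (P \<union> N))"
    by (rule linear_independent_injective_image[OF assms(2) PN(6) inj_on_subset[OF inj subset_UNIV]])
  moreover have "span (F ` (P \<union> N)) = UNIV"
    by (simp add: linear_span_image[OF assms(2)] PN(7) surj)
  moreover have "card (F ` P) = r" "card (F ` N) = s" "F ` P \<inter> F ` N = {}"
    using PN(3-5) inj by (auto simp: card_image inj_on_subset[OF inj] image_Int[symmetric])
  moreover have "B x y = 0" if "x \<in> P \<union> N" "y \<in> P \<union> N" "F x \<noteq> F y" for x y
    using PN(10) that by metis
  ultimately show ?thesis
    using PN(1,2,8,9) unfolding has_signature_def
    by - (rule exI[of _ "F ` P"], rule exI[of _ "F ` N"], auto simp: assms(3) image_Un)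
qed

text \<open>Rescaling the standard basis gives an orthonormal one.\<close>

lemma has_signature_flow_form:
  assumes "a \<noteq> 0" "b \<noteq> 0" "c \<noteq> 0"
  shows "has_signature (flow_form a b c) 2 2"
proof -
  define P :: "quad set" where "P = {(1, 0, 0, 0), (0, 1 / a, 0, 0)}"
  define N :: "quad set" where "N = {(0, 0, 1 / b, 0), (0, 0, 0, 1 / c)}"
  have "x \<in> span (P \<union> N)" for x :: quad
  proof -
    obtain x0 x1 x2 x3 where x: "x = (x0, x1, x2, x3)"
      by (cases x) auto
    have "x = x0 *\<^sub>R (1, 0, 0, 0) + (a * x1) *\<^sub>R (0, 1 / a, 0, 0)
        + (b * x2) *\<^sub>R (0, 0, 1 / b, 0) + (c * x3) *\<^sub>R (0, 0, 0, 1 / c)"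
      using assms by (simp add: x)
    also have "\<dots> \<in> span (P \<union> N)"
      by (intro span_add span_scale span_base) (auto simp: P_def N_def)
    finally show ?thesis .
  qed
  then have span: "span (P \<union> N) = UNIV"
    by auto
  have card: "card P = 2" "card N = 2" "finite P" "finite N" "P \<inter> N = {}"
    using assms by (auto simp: P_def N_def)
  \<comment> \<open>Four spanning vectors in dimension four are independent.\<close>
  then have "card (P \<union> N) \<le> dim (UNIV :: quad set)"
    by (simp add: card_Un_disjoint)
  then have "independent (P \<union> N)"
    using span card by (intro card_le_dim_spanning[of _ UNIV]) auto
  with span card show ?thesis
    unfolding has_signature_def using assms
    by - (rule exI[of _ P], rule exI[of _ N],
        auto simp: P_def N_def flow_form_def power2_eq_square)
qed

section \<open>The flow metric on \<open>I \<times> E(1,1)\<close>\<close>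

context lorentz_frame
begin

definition spacetime_coframe :: "real \<times> e11 \<Rightarrow> real \<times> e11 \<Rightarrow> quad" where
  "spacetime_coframe q u =
     (fst u, \<theta>1 (snd q) (snd u), \<theta>2 (snd q) (snd u), \<theta>3 (snd q) (snd u))"

definition spacetime_frame :: "real \<times> e11 \<Rightarrow> quad \<Rightarrow> real \<times> e11" where
  "spacetime_frame q = (\<lambda>(y0, y1, y2, y3).
     (y0, y1 *\<^sub>R F1 (snd q) + y2 *\<^sub>R F2 (snd q) + y3 *\<^sub>R F3 (snd q)))"

lemma linear_spacetime_coframe: "linear (spacetime_coframe q)"
  by (rule linearI) (simp_all add: spacetime_coframe_def coframe_linear_simps)

lemma linear_spacetime_frame: "linear (spacetime_frame q)"
  by (auto simp: spacetime_frame_def algebra_simps intro!: linearI)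

lemma spacetime_coframe_frame: "spacetime_coframe q (spacetime_frame q y) = y"
  by (cases y) (simp add: spacetime_coframe_def spacetime_frame_def coframe_linear_simps)

lemma spacetime_frame_coframe: "spacetime_frame q (spacetime_coframe q u) = u"
  by (cases u) (simp add: spacetime_coframe_def spacetime_frame_def frame_expansion)

lemma spacetime_coframe_derivative:
  "((\<lambda>q. spacetime_coframe q v) has_derivative
     (\<lambda>u. - frame_product drift1 drift3 (spacetime_coframe p u) (spacetime_coframe p v))) (at p)"
proof -
  note snd = has_derivative_snd[OF has_derivative_ident]
  have "((\<lambda>q. \<theta>1 (snd q) (snd v)) has_derivative
      (\<lambda>u. - (\<theta>2 (snd p) (snd u) * (\<theta>3 (snd p) (snd v) + drift1 * \<theta>2 (snd p) (snd v))))) (at p)"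
    "((\<lambda>q. \<theta>2 (snd q) (snd v)) has_derivative (\<lambda>u. 0)) (at p)"
    "((\<lambda>q. \<theta>3 (snd q) (snd v)) has_derivative
      (\<lambda>u. - (\<theta>2 (snd p) (snd u) * (\<theta>1 (snd p) (snd v) + drift3 * \<theta>2 (snd p) (snd v))))) (at p)"
    by (rule has_derivative_compose[OF snd coframe_derivatives(1)]
        has_derivative_compose[OF snd coframe_derivatives(2)]
        has_derivative_compose[OF snd coframe_derivatives(3)])+
  from has_derivative_Pair[OF has_derivative_const has_derivative_Pair[OF this(1)
        has_derivative_Pair[OF this(2,3)]], of "fst v"]
  show ?thesis
    by (simp add: spacetime_coframe_def frame_product_def)
qed

lemma spacetime_frame_derivative:
  "((\<lambda>q. spacetime_frame q y) has_derivative
     (\<lambda>u. spacetime_frame p (frame_product drift1 drift3 (spacetime_coframe p u) y))) (at p)"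
proof -
  note snd = has_derivative_snd[OF has_derivative_ident]
  have D: "((\<lambda>q. F1 (snd q)) has_derivative (\<lambda>u. \<theta>2 (snd p) (snd u) *\<^sub>R F3 (snd p))) (at p)"
    "((\<lambda>q. F2 (snd q)) has_derivative
      (\<lambda>u. \<theta>2 (snd p) (snd u) *\<^sub>R (drift1 *\<^sub>R F1 (snd p) + drift3 *\<^sub>R F3 (snd p)))) (at p)"
    "((\<lambda>q. F3 (snd q)) has_derivative (\<lambda>u. \<theta>2 (snd p) (snd u) *\<^sub>R F1 (snd p))) (at p)"
    by (rule has_derivative_compose[OF snd frame_derivatives(1)]
        has_derivative_compose[OF snd frame_derivatives(2)]
        has_derivative_compose[OF snd frame_derivatives(3)])+
  obtain y0 y1 y2 y3 where y: "y = (y0, y1, y2, y3)"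
    by (cases y) auto
  from has_derivative_Pair[OF has_derivative_const has_derivative_add[OF has_derivative_add[OF
      has_derivative_scaleR_right[OF D(1)] has_derivative_scaleR_right[OF D(2)]]
      has_derivative_scaleR_right[OF D(3)]], of y0 y1 y2 y3]
  show ?thesis
    unfolding y spacetime_frame_def prod.case
    by (rule has_derivative_eq_rhs)
      (simp add: spacetime_coframe_def frame_product_def fun_eq_iff algebra_simps)
qed

lemma flow_metric_frame:
  "flow_metric a b c \<theta>1 \<theta>2 \<theta>3 = (\<lambda>q u v.
     flow_form (a (fst q)) (b (fst q)) (c (fst q)) (spacetime_coframe q u) (spacetime_coframe q v))"
  by (simp add: fun_eq_iff flow_metric_def flow_form_def spacetime_coframe_def)

lemma flow_metric_pseudo_riemannian:
  assumes "open I" and smooth: "smooth_on I a" "smooth_on I b" "smooth_on I c"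
    and nz: "\<And>t. t \<in> I \<Longrightarrow> a t \<noteq> 0 \<and> b t \<noteq> 0 \<and> c t \<noteq> 0"
  shows "pseudo_riemannian_metric_on (I \<times> UNIV) 2 2 (flow_metric a b c \<theta>1 \<theta>2 \<theta>3)"
  unfolding pseudo_riemannian_metric_on_def
proof (intro conjI allI ballI)
  let ?U = "I \<times> (UNIV :: e11 set)" and ?g = "flow_metric a b c \<theta>1 \<theta>2 \<theta>3"
  show U: "open ?U"
    by (intro open_Times assms open_UNIV)
  have factor: "smooth_on ?U (\<lambda>q. f (fst q))" if "smooth_on I f" for f :: "real \<Rightarrow> real"
    using that Ck_on_compose_linear[OF bounded_linear_fst U, of I _ f]
    by (simp add: smooth_on_def image_subset_iff)
  have coframe: "smooth_on ?U (\<lambda>q. L (spacetime_coframe q v))"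
    if "bounded_linear L" for L :: "quad \<Rightarrow> real" and v
    using smooth_on_coframe[OF U bilinear_frame_product spacetime_coframe_derivative, of v]
      Ck_on_bounded_linear[OF that U]
    by (simp add: smooth_on_def)
  fix u v
  have "?g q u v = fst (spacetime_coframe q u) * fst (spacetime_coframe q v)
      + a (fst q) * a (fst q)
        * (fst (snd (spacetime_coframe q u)) * fst (snd (spacetime_coframe q v)))
      - b (fst q) * b (fst q)
        * (fst (snd (snd (spacetime_coframe q u))) * fst (snd (snd (spacetime_coframe q v))))
      - c (fst q) * c (fst q)
        * (snd (snd (snd (spacetime_coframe q u))) * snd (snd (snd (spacetime_coframe q v))))" for q
    by (simp add: flow_metric_frame flow_form_def case_prod_beta power2_eq_square)
  then show "smooth_on ?U (\<lambda>q. ?g q u v)"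
    by (simp only:) (intro smooth_on_add smooth_on_diff smooth_on_mult U factor smooth coframe
        bounded_linear_intros)
next
  fix q u v assume q: "q \<in> I \<times> (UNIV :: e11 set)"
  have "linear (flow_form (a (fst q)) (b (fst q)) (c (fst q)) x)"
    "linear (\<lambda>x. flow_form (a (fst q)) (b (fst q)) (c (fst q)) x y)" for x y
    using bilinear_flow_form by (simp_all only: bilinear_def)
  then show "bilinear (flow_metric a b c \<theta>1 \<theta>2 \<theta>3 q)"
    unfolding bilinear_def flow_metric_frame
    by (intro conjI allI linear_compose[OF linear_spacetime_coframe, unfolded o_def])
  show "flow_metric a b c \<theta>1 \<theta>2 \<theta>3 q u v = flow_metric a b c \<theta>1 \<theta>2 \<theta>3 q v u"
    by (simp add: flow_metric_frame flow_form_commute)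
  have "has_signature (flow_form (a (fst q)) (b (fst q)) (c (fst q))) 2 2"
    using q nz by (intro has_signature_flow_form) auto
  from has_signature_pullback[OF this linear_spacetime_frame spacetime_coframe_frame
      spacetime_frame_coframe]
  show "has_signature (flow_metric a b c \<theta>1 \<theta>2 \<theta>3 q) 2 2"
    by (simp add: flow_metric_frame)
qed

text \<open>It remains to check that the frame, the diagonal form and the flow connection satisfy the axioms of
a framed metric; the Ricci tensor is then the trace computed before.\<close>

lemma flow_metric_ricci_flat:
  assumes "open I" and flow: "flow_solution I a b c"
  shows "ricci_flat_on (I \<times> UNIV) (flow_metric a b c \<theta>1 \<theta>2 \<theta>3)"
proof -
  have nz: "a (fst p) \<noteq> 0" "b (fst p) \<noteq> 0" "c (fst p) \<noteq> 0"
    if "p \<in> I \<times> (UNIV :: e11 set)" for p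
    using that flow by (auto simp: flow_solution_def)
  interpret M: framed_metric "I \<times> UNIV" spacetime_coframe spacetime_frame
    "frame_product drift1 drift3"
    "\<lambda>p. flow_form (a (fst p)) (b (fst p)) (c (fst p))"
    "\<lambda>p. flow_connection (a (fst p)) (b (fst p)) (c (fst p))"
    "\<lambda>p x y z. fst x *\<^sub>R flow_connection_rate (a (fst p)) (b (fst p)) (c (fst p)) y z"
  proof (rule framed_metric.intro)
    show "open (I \<times> (UNIV :: e11 set))"
      by (intro open_Times assms open_UNIV)
    show "x = 0" if "p \<in> I \<times> UNIV"
      and "\<And>y. flow_form (a (fst p)) (b (fst p)) (c (fst p)) x y = 0" for p :: "real \<times> e11" and x
      by (rule flow_form_nondegenerate[OF nz[OF that(1)] that(2)])
    show "linear (\<lambda>x :: quad. fst x *\<^sub>R flow_connection_rate (a (fst p)) (b (fst p)) (c (fst p)) y z)"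
      for p :: "real \<times> e11" and y z
      by (auto intro!: linearI simp: algebra_simps)
    show "linear (\<lambda>y. fst x *\<^sub>R flow_connection_rate (a (fst p)) (b (fst p)) (c (fst p)) y z)"
      for p :: "real \<times> e11" and x :: quad and z
      using bilinear_flow_connection_rate[of "a (fst p)" "b (fst p)" "c (fst p)"]
      by (intro linear_compose_scale_right) (simp only: bilinear_def)
  next
    fix p :: "real \<times> e11" and x y assume p: "p \<in> I \<times> UNIV"
    then have t: "fst p \<in> I"
      by auto
    have "((\<lambda>q. flow_connection (a (fst q)) (b (fst q)) (c (fst q)) x y) has_derivative
        (\<lambda>u. fst u *\<^sub>R flow_connection_rate (a (fst p)) (b (fst p)) (c (fst p)) x y)) (at p)"
      by (rule has_derivative_compose[OF has_derivative_fst[OF has_derivative_ident]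
            flow_connection_derivative[OF flow t, unfolded has_vector_derivative_def]])
    then show "((\<lambda>q. flow_connection (a (fst q)) (b (fst q)) (c (fst q)) x y) has_derivative
        (\<lambda>u. fst (spacetime_coframe p u) *\<^sub>R
          flow_connection_rate (a (fst p)) (b (fst p)) (c (fst p)) x y)) (at p)"
      by (simp add: spacetime_coframe_def)
    obtain d where d: "((\<lambda>t. flow_form (a t) (b t) (c t) x y) has_real_derivative d) (at (fst p))"
      and d_eq: "\<And>w. fst w * d =
          flow_form (a (fst p)) (b (fst p)) (c (fst p))
            (flow_connection (a (fst p)) (b (fst p)) (c (fst p)) w x) y
          + flow_form (a (fst p)) (b (fst p)) (c (fst p)) x
            (flow_connection (a (fst p)) (b (fst p)) (c (fst p)) w y)"
      using flow_form_derivative[OF flow t, of x y] by blast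
    have "((\<lambda>q. flow_form (a (fst q)) (b (fst q)) (c (fst q)) x y) has_derivative
        (\<lambda>u. fst u * d)) (at p)"
      using has_derivative_compose[OF has_derivative_fst[OF has_derivative_ident]
          d[unfolded has_field_derivative_def], of UNIV]
      by (simp add: mult.commute)
    then show "((\<lambda>q. flow_form (a (fst q)) (b (fst q)) (c (fst q)) x y) has_derivative
        (\<lambda>u. flow_form (a (fst p)) (b (fst p)) (c (fst p))
            (flow_connection (a (fst p)) (b (fst p)) (c (fst p)) (spacetime_coframe p u) x) y
          + flow_form (a (fst p)) (b (fst p)) (c (fst p)) x
            (flow_connection (a (fst p)) (b (fst p)) (c (fst p)) (spacetime_coframe p u) y))) (at p)"
      by (simp add: spacetime_coframe_def flip: d_eq)
  qed (rule linear_spacetime_coframe linear_spacetime_frame spacetime_coframe_frame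
      spacetime_frame_coframe bilinear_frame_product bilinear_flow_form bilinear_flow_connection
      spacetime_coframe_derivative spacetime_frame_derivative frame_product_flat
      flow_form_commute flow_connection_torsion_free)+
  have "flow_metric a b c \<theta>1 \<theta>2 \<theta>3 = M.frame_metric"
    by (simp add: fun_eq_iff flow_metric_frame M.frame_metric_def)
  then show ?thesis
    by (simp add: ricci_flat_on_def M.ricci_frame M.frame_curvature_def
        flow_curvature_trace[OF nz])
qed

end

theorem theorem4p4:
  fixes I :: "real set" and a b c :: "real \<Rightarrow> real"
    and F1 F2 F3 :: "e11 \<Rightarrow> e11" and \<theta>1 \<theta>2 \<theta>3 :: "e11 \<Rightarrow> e11 \<Rightarrow> real"
  assumes "left_invariant_frame F1 F2 F3"
    and "\<And>p. lie_bracket F1 F2 p = - F3 p"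
    and "\<And>p. lie_bracket F3 F1 p = 0"
    and "\<And>p. lie_bracket F2 F3 p = F1 p"
    and "dual_coframe F1 F2 F3 \<theta>1 \<theta>2 \<theta>3"
    and "open I" and "is_interval I"
    and "smooth_on I a" and "smooth_on I b" and "smooth_on I c"
    and "\<And>t. t \<in> I \<Longrightarrow> a t \<noteq> 0 \<and> b t \<noteq> 0 \<and> c t \<noteq> 0"
    and "\<And>t. t \<in> I \<Longrightarrow>
           (a has_real_derivative ((c t)\<^sup>2 - (a t)\<^sup>2) / (2 * b t * c t)) (at t)"
    and "\<And>t. t \<in> I \<Longrightarrow>
           (b has_real_derivative (c t + a t)\<^sup>2 / (2 * c t * a t)) (at t)"
    and "\<And>t. t \<in> I \<Longrightarrow>
           (c has_real_derivative ((a t)\<^sup>2 - (c t)\<^sup>2) / (2 * a t * b t)) (at t)"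
  shows "pseudo_riemannian_metric_on (I \<times> UNIV) 2 2 (flow_metric a b c \<theta>1 \<theta>2 \<theta>3) \<and>
         ricci_flat_on (I \<times> UNIV) (flow_metric a b c \<theta>1 \<theta>2 \<theta>3)"
proof -
  interpret lorentz_frame F1 F2 F3 \<theta>1 \<theta>2 \<theta>3
    using assms(1-5) by unfold_locales
  have "a t * shear (a t) (b t) (c t) = ((c t)\<^sup>2 - (a t)\<^sup>2) / (2 * b t * c t)"
    "b t * expansion (a t) (b t) (c t) = (c t + a t)\<^sup>2 / (2 * c t * a t)"
    "- c t * shear (a t) (b t) (c t) = ((a t)\<^sup>2 - (c t)\<^sup>2) / (2 * a t * b t)" if "t \<in> I" for t
    using assms(11)[OF that] by (simp_all add: shear_def expansion_def field_simps)
  then have "flow_solution I a b c"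
    unfolding flow_solution_def using assms(11-14) by simp
  then show ?thesis
    using flow_metric_pseudo_riemannian[OF assms(6,8-11)] flow_metric_ricci_flat[OF assms(6)]
    by simp
qed

end
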